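(* Let $n\ge 1$ and $m\ge 0$ be integers, and let $\Psi_x(e^{i\vartheta})=\sum_{k=-m}^{m}e^{-ik\vartheta}R_k\in\mathcal{Q}_{n,m}$ (with $R_k=R_{-k}^T\in\mathbb{R}^{n\times n}$) satisfy $\Psi_x\succeq 0$. Consider the problem (P) $$\min_{\Psi_y,\Psi_z\in\mathcal{Q}_{n,m}}\ \operatorname{tr}\int_{-\pi}^{\pi}\Psi_y(e^{i\vartheta})\,\frac{\mathrm{d}\vartheta}{2\pi}\quad\text{subject to}\quad \Psi_y\succeq 0,\ \Psi_z\succeq 0,\ \Psi_z\text{ diagonal},\ \Psi_x=\Psi_y+\Psi_z,$$ and the matrix semidefinite program (S) $$\min_{Y,Z\in\mathbf{Q}_{n(m+1)}}\ \operatorname{tr}(Y)\quad\text{subject to}\quad Y\succeq 0,\ Z\succeq 0,\ \ \mathrm{D}_k(Z)\text{ diagonal for } k=0,\dots,m,\ \ \mathrm{D}_k(Y+Z)=R_k\text{ for } k=0,\dots,m.$$ Then (P) and (S) are equivalent: they have the same optimal value, and if $(\hat Y,\hat Z)$ is a solution (minimizer) of (S), then $$\hat\Psi_y(e^{i\vartheta})=\Delta(e^{i\vartheta})\,\hat Y\,\Delta(e^{i\vartheta})^*,\qquad \hat\Psi_z(e^{i\vartheta})=\Delta(e^{i\vartheta})\,\hat Z\,\Delta(e^{i\vartheta})^*$$ is a solution of (P).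
   Context: $\mathbf{Q}_p$ denotes the vector space of real symmetric $p\times p$ matrices; for a symmetric matrix, $\succeq 0$ means positive semidefinite. $\mathcal{Q}_{n,m}$ denotes the real vector space of matrix pseudo-polynomials on the unit circle $$\mathcal{Q}_{n,m}=\Big\{\sum_{k=-m}^{m}e^{-ik\vartheta}Q_k \;:\; Q_k=Q_{-k}^T\in\mathbb{R}^{n\times n}\Big\},$$ regarded as functions of $e^{i\vartheta}$, $\vartheta\in[-\pi,\pi]$. For such a function, $\Psi\succeq 0$ means that $\Psi(e^{i\vartheta})$ is positive semidefinite for every $\vartheta\in[-\pi,\pi]$, and "$\Psi$ diagonal" means that $\Psi(e^{i\vartheta})$ is a diagonal matrix for every $\vartheta$. The shift operator is the $n\times n(m+1)$ matrix function $$\Delta(e^{i\vartheta})=\begin{bmatrix} I_n & e^{i\vartheta}I_n & \cdots & e^{im\vartheta}I_n\end{bmatrix},$$ and $^*$ denotes conjugate transpose. A matrix $Y\in\mathbf{Q}_{n(m+1)}$ is partitioned into $n\times n$ blocks $Y_{jl}$, $j,l=0,\dots,m$. The linear maps $\mathrm{D}_k$ are defined by $$\mathrm{D}_k(Y)=\sum_{j=0}^{m-k}Y_{j,j+k}\in\mathbb{R}^{n\times n},\qquad k=0,1,\dots,m$$ (so $\mathrm{D}_0(Y)=\sum_{j=0}^m Y_{jj}\in\mathbf{Q}_n$). *)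

theory Defs
  imports
    "HOL-Analysis.Analysis"
    "Jordan_Normal_Form.Matrix"
    "Jordan_Normal_Form.Schur_Decomposition"
begin

hide_const (open) Finite_Cartesian_Product.mat Finite_Cartesian_Product.vec Determinants.trace

definition trace_mat :: "'a :: comm_monoid_add mat \<Rightarrow> 'a" where
  "trace_mat A = (\<Sum>i<dim_row A. A $$ (i, i))"

(* The space of real symmetric p x p matrices. *)
definition sym_mats :: "nat \<Rightarrow> real mat set" where
  "sym_mats p = {A \<in> carrier_mat p p. transpose_mat A = A}"

(* Used for 'a = real and 'a = complex. On the reals, conjugation is the identity. On the
   complex numbers, 0 \<le> w means that w is real and nonnegative, and (A v) \<bullet>c v is v* A v. *)
definition psd :: "'a :: conjugatable_ordered_field mat \<Rightarrow> bool" where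
  "psd A \<longleftrightarrow> square_mat A \<and> mat_adjoint A = A \<and>
     (\<forall>v \<in> carrier_vec (dim_row A). 0 \<le> (A *\<^sub>v v) \<bullet>c v)"

(* Functions on the unit circle are represented by functions of the angle. *)
type_synonym circle_fun = "real \<Rightarrow> complex mat"

definition pseudo_poly :: "nat \<Rightarrow> nat \<Rightarrow> (int \<Rightarrow> real mat) \<Rightarrow> circle_fun" where
  "pseudo_poly n m Q = (\<lambda>\<theta>. mat n n (\<lambda>(a, b).
     \<Sum>k = - int m..int m. exp (- (\<i> * of_int k * of_real \<theta>)) * of_real (Q k $$ (a, b))))"

definition coeff_family :: "nat \<Rightarrow> nat \<Rightarrow> (int \<Rightarrow> real mat) \<Rightarrow> bool" where
  "coeff_family n m Q \<longleftrightarrow>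
     (\<forall>k \<in> {- int m..int m}. Q k \<in> carrier_mat n n \<and> Q k = transpose_mat (Q (- k)))"

definition pseudo_polys :: "nat \<Rightarrow> nat \<Rightarrow> circle_fun set" where
  "pseudo_polys n m = {pseudo_poly n m Q | Q. coeff_family n m Q}"

definition circle_psd :: "circle_fun \<Rightarrow> bool" where
  "circle_psd \<Psi> \<longleftrightarrow> (\<forall>\<theta> \<in> {-pi..pi}. psd (\<Psi> \<theta>))"

definition circle_diagonal :: "circle_fun \<Rightarrow> bool" where
  "circle_diagonal \<Psi> \<longleftrightarrow> (\<forall>\<theta> \<in> {-pi..pi}. diagonal_mat (\<Psi> \<theta>))"

(* Entrywise integral with respect to d\<theta> / (2 \<pi>). *)
definition circle_integral :: "nat \<Rightarrow> circle_fun \<Rightarrow> complex mat" where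
  "circle_integral n \<Psi> =
     mat n n (\<lambda>(a, b). integral {-pi..pi} (\<lambda>\<theta>. \<Psi> \<theta> $$ (a, b) / of_real (2 * pi)))"

definition shift_op :: "nat \<Rightarrow> nat \<Rightarrow> circle_fun" where
  "shift_op n m = (\<lambda>\<theta>. mat n (n * (m + 1))
     (\<lambda>(a, c). if a = c mod n then exp (\<i> * of_nat (c div n) * of_real \<theta>) else 0))"

definition block :: "nat \<Rightarrow> 'a mat \<Rightarrow> nat \<Rightarrow> nat \<Rightarrow> 'a mat" where
  "block n Y j l = mat n n (\<lambda>(a, b). Y $$ (j * n + a, l * n + b))"

definition D_map :: "nat \<Rightarrow> nat \<Rightarrow> nat \<Rightarrow> real mat \<Rightarrow> real mat" where
  "D_map n m k Y = mat n n (\<lambda>(a, b). \<Sum>j = 0..m - k. block n Y j (j + k) $$ (a, b))"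

definition sandwich :: "nat \<Rightarrow> nat \<Rightarrow> real mat \<Rightarrow> circle_fun" where
  "sandwich n m Y =
     (\<lambda>\<theta>. shift_op n m \<theta> * map_mat of_real Y * mat_adjoint (shift_op n m \<theta>))"

definition P_feasible :: "nat \<Rightarrow> nat \<Rightarrow> circle_fun \<Rightarrow> circle_fun \<times> circle_fun \<Rightarrow> bool" where
  "P_feasible n m \<Psi>x = (\<lambda>(\<Psi>y, \<Psi>z).
     \<Psi>y \<in> pseudo_polys n m \<and> \<Psi>z \<in> pseudo_polys n m \<and>
     circle_psd \<Psi>y \<and> circle_psd \<Psi>z \<and> circle_diagonal \<Psi>z \<and>
     (\<forall>\<theta> \<in> {-pi..pi}. \<Psi>x \<theta> = \<Psi>y \<theta> + \<Psi>z \<theta>))"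

(* Elements of pseudo_polys have Hermitian values, so the trace below is real. *)
definition P_objective :: "nat \<Rightarrow> circle_fun \<times> circle_fun \<Rightarrow> real" where
  "P_objective n = (\<lambda>(\<Psi>y, \<Psi>z). Re (trace_mat (circle_integral n \<Psi>y)))"

definition S_feasible :: "nat \<Rightarrow> nat \<Rightarrow> (int \<Rightarrow> real mat) \<Rightarrow> real mat \<times> real mat \<Rightarrow> bool" where
  "S_feasible n m R = (\<lambda>(Y, Z).
     Y \<in> sym_mats (n * (m + 1)) \<and> Z \<in> sym_mats (n * (m + 1)) \<and>
     psd Y \<and> psd Z \<and>
     (\<forall>k \<le> m. diagonal_mat (D_map n m k Z)) \<and>
     (\<forall>k \<le> m. D_map n m k (Y + Z) = R (int k)))"

definition S_objective :: "real mat \<times> real mat \<Rightarrow> real" where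
  "S_objective = (\<lambda>(Y, Z). trace_mat Y)"

(* The infimum is taken in the extended reals, so that it is meaningful without knowing
   beforehand that the problem is feasible and bounded below. *)
definition optimal_value :: "('a \<Rightarrow> real) \<Rightarrow> ('a \<Rightarrow> bool) \<Rightarrow> ereal" where
  "optimal_value f feasible = (INF x \<in> Collect feasible. ereal (f x))"

end

theory Submission
  imports Defs
begin

text \<open>
  Since \<open>\<Delta> Y \<Delta>\<^sup>*\<close> has Fourier coefficients \<open>D\<^sub>k(Y)\<close>, a feasible pair of (S) yields a feasible pair of
  (P) with the same objective value. The converse needs a real positive semidefinite \<open>Y\<close> with
  \<open>D\<^sub>k(Y) = Q\<^sub>k\<close> for every positive semidefinite \<open>\<Psi> = \<Sum> e\<^sup>-\<^sup>i\<^sup>k\<^sup>\<theta> Q\<^sub>k\<close>. Every finite section \<open>T\<close> (with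
  \<open>N + 1\<close> block rows) of the block Toeplitz matrix of \<open>\<Psi>\<close> is positive semidefinite, as its quadratic form is an
  integral of values \<open>w\<^sup>* \<Psi> w\<close>. It is banded, so its Cholesky factorisation writes it as a sum of
  positive semidefinite matrices of rank at most one, each supported in a window of \<open>m + 1\<close> consecutive
  blocks. Shifting all windows to the origin and averaging gives \<open>Y\<^sub>N \<succeq> 0\<close> with
  \<open>D\<^sub>k(Y\<^sub>N) = (N + 1 - k) / (N + 1) Q\<^sub>k\<close>. The matrices \<open>Y\<^sub>N\<close> are bounded because their traces are,
  and any limit point is the required \<open>Y\<close>.
\<close>

unbundle no vec_syntax
unbundle no inner_syntax

section \<open>Banded Cholesky factorisation\<close>

text \<open>Matrices are plain index functions here, so that Schur complements and shifted windows
  need no dimension bookkeeping; \<open>real_psd_iff\<close> links this form to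
  \<open>psd\<close>.\<close>

definition quad_form :: "nat \<Rightarrow> (nat \<Rightarrow> nat \<Rightarrow> real) \<Rightarrow> (nat \<Rightarrow> real) \<Rightarrow> real" where
  "quad_form p A v = (\<Sum>i<p. \<Sum>j<p. A i j * v i * v j)"

text \<open>The expansion in powers of \<open>t\<close> along one coordinate direction. Varying
  \<open>t\<close> kills the row of a zero pivot, \<open>t = - s / A c c\<close> completes the
  square for a Schur complement, and \<open>t = 1\<close>, \<open>t = -1\<close> bound the
  entries.\<close>

lemma quad_form_add_unit:
  assumes sym: "\<And>i j. i < p \<Longrightarrow> j < p \<Longrightarrow> A i j = A j i" and c: "c < p"
  shows "quad_form p A (\<lambda>i. v i + (if i = c then t else 0))
           = quad_form p A v + 2 * t * (\<Sum>j<p. A c j * v j) + t\<^sup>2 * A c c"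
proof -
  have "A i j * (v i + (if i = c then t else 0)) * (v j + (if j = c then t else 0))
     = A i j * v i * v j + (if i = c then t * (A i j * v j) else 0)
       + (if j = c then t * (A i j * v i) else 0)
       + (if i = c then if j = c then t\<^sup>2 * A i j else 0 else 0)" for i j
    by (simp add: algebra_simps power2_eq_square)
  then have "quad_form p A (\<lambda>i. v i + (if i = c then t else 0))
     = quad_form p A v + (\<Sum>i<p. \<Sum>j<p. if i = c then t * (A i j * v j) else 0)
       + (\<Sum>i<p. \<Sum>j<p. if j = c then t * (A i j * v i) else 0)
       + (\<Sum>i<p. \<Sum>j<p. if i = c then if j = c then t\<^sup>2 * A i j else 0 else 0)"
    by (simp add: quad_form_def sum.distrib)
  also have "(\<Sum>i<p. \<Sum>j<p. if i = c then t * (A i j * v j) else 0) = t * (\<Sum>j<p. A c j * v j)"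
    by (subst sum.swap) (use c in \<open>simp add: sum_distrib_left\<close>)
  also have "(\<Sum>i<p. \<Sum>j<p. if j = c then t * (A i j * v i) else 0) = t * (\<Sum>j<p. A c j * v j)"
    using c sym by (simp add: sum_distrib_left)
  also have "(\<Sum>i<p. \<Sum>j<p. if i = c then if j = c then t\<^sup>2 * A i j else 0 else 0) = t\<^sup>2 * A c c"
    by (subst sum.swap) (use c in \<open>simp add: sum.delta\<close>)
  finally show ?thesis by simp
qed

lemma linear_nonneg_imp_slope_zero:
  fixes a b :: real
  assumes "\<And>t. 0 \<le> a + t * b"
  shows "b = 0"
proof (rule ccontr)
  assume "b \<noteq> 0"
  \<comment> \<open>At this \<open>t\<close> the right-hand side equals \<open>-1\<close>.\<close>
  then show False using assms[of "- (a + 1) / b"] by simp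
qed

text \<open>With \<open>A c c = 0\<close> the form at \<open>e_j + t e_c\<close> has no quadratic
  term in \<open>t\<close>, so it is affine in \<open>t\<close> and nonnegative everywhere; its
  slope \<open>2 * A c j\<close> must vanish.\<close>

lemma psd_row_eq_0:
  assumes sym: "\<And>i j. i < p \<Longrightarrow> j < p \<Longrightarrow> A i j = A j i"
    and psd: "\<And>v. 0 \<le> quad_form p A v"
    and c: "c < p" "A c c = 0" and j: "j < p"
  shows "A c j = 0"
proof -
  let ?e = "\<lambda>i. if i = j then 1 else 0"
  have "0 \<le> quad_form p A ?e + t * (2 * A c j)" for t
  proof -
    have "(\<Sum>i<p. A c i * ?e i) = (\<Sum>i<p. if i = j then A c i else 0)"
      by (intro sum.cong) auto
    also have "\<dots> = A c j"
      using j by (simp add: sum.delta)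
    finally show ?thesis
      using psd[of "\<lambda>i. ?e i + (if i = c then t else 0)"] quad_form_add_unit[OF sym c(1), where v = ?e and t = t] c(2)
      by (simp add: mult_ac)
  qed
  from linear_nonneg_imp_slope_zero[OF this] show ?thesis by simp
qed

text \<open>For \<open>A c c = 0\<close> the subtracted term is 0, as division by zero yields 0.\<close>

lemma schur_complement_psd:
  assumes sym: "\<And>i j. i < p \<Longrightarrow> j < p \<Longrightarrow> A i j = A j i"
    and psd: "\<And>v. 0 \<le> quad_form p A v" and c: "c < p"
  shows "0 \<le> quad_form p (\<lambda>i j. A i j - A c i * A c j / A c c) v"
proof -
  define s where "s = (\<Sum>j<p. A c j * v j)"
  have "(\<Sum>i<p. \<Sum>j<p. A c i * A c j / A c c * v i * v j) = s\<^sup>2 / A c c"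
    unfolding s_def power2_eq_square sum_product sum_divide_distrib by (simp add: mult_ac)
  then have eq: "quad_form p (\<lambda>i j. A i j - A c i * A c j / A c c) v = quad_form p A v - s\<^sup>2 / A c c"
    by (simp add: quad_form_def left_diff_distrib sum_subtractf)
  show ?thesis
  proof (cases "A c c = 0")
    case True then show ?thesis using psd eq by simp
  next
    case False
    \<comment> \<open>Completing the square: the form of the Schur complement at \<open>v\<close> is
      the form of \<open>A\<close> at a vector that differs from \<open>v\<close> only in coordinate
      \<open>c\<close>.\<close>
    have "quad_form p A (\<lambda>i. v i + (if i = c then - s / A c c else 0))
        = quad_form p A v - s\<^sup>2 / A c c"
      using quad_form_add_unit[OF sym c, where v = v and t = "- s / A c c"] False
      by (simp add: s_def[symmetric] power2_eq_square)
    then show ?thesis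
      using psd[of "\<lambda>i. v i + (if i = c then - s / A c c else 0)"] eq by simp
  qed
qed

lemma psd_diag_nonneg:
  assumes psd: "\<And>v. 0 \<le> quad_form p A v" and c: "c < p"
  shows "0 \<le> A c c"
proof -
  have "quad_form p A (\<lambda>i. if i = c then 1 else 0)
     = (\<Sum>i<p. \<Sum>j<p. if j = c then if i = c then A i j else 0 else 0)"
    unfolding quad_form_def by (intro sum.cong) auto
  also have "\<dots> = A c c" using c by (simp add: sum.delta)
  finally show ?thesis using psd by metis
qed

text \<open>Gaussian elimination by induction on the number \<open>p - c\<close> of remaining
  pivots; \<open>c\<close> counts the rows already cleared. The function \<open>b\<close> stands for
  the block index. Row \<open>c\<close> is supported between \<open>c\<close> and the end of block
  \<open>b c + m\<close>, and monotonicity of \<open>b\<close> keeps the fill-in inside the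
  band.\<close>

lemma banded_cholesky_from:
  assumes mono: "mono b"
  assumes sym: "\<And>i j. i < p \<Longrightarrow> j < p \<Longrightarrow> A i j = A j i"
    and psd: "\<And>v. 0 \<le> quad_form p A v"
    and band: "\<And>i j. i < p \<Longrightarrow> j < p \<Longrightarrow> b i + m < b j \<Longrightarrow> A i j = 0"
    and zero: "\<And>i j. i < p \<Longrightarrow> j < p \<Longrightarrow> i < c \<Longrightarrow> A i j = 0"
    and "c \<le> p"
  shows "\<exists>V :: nat \<Rightarrow> nat \<Rightarrow> real. (\<forall>i<p. \<forall>j<p. A i j = (\<Sum>k = c..<p. V k i * V k j)) \<and>
     (\<forall>k i. V k i \<noteq> 0 \<longrightarrow> k \<le> i \<and> i < p \<and> b i \<le> b k + (m::nat))"
  using \<open>c \<le> p\<close> sym psd band zero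
proof (induction "p - c" arbitrary: c A)
  case 0
  then have "c = p" by simp
  show ?case
    by (rule exI[of _ "\<lambda>_ _. 0"]) (use 0(6) \<open>c = p\<close> in auto)
next
  case (Suc d)
  note sym = Suc.prems(2) and psd = Suc.prems(3) and band = Suc.prems(4) and zero = Suc.prems(5)
  have c: "c < p" using Suc.hyps(2) by simp
  have pos: "0 \<le> A c c" using psd_diag_nonneg[OF psd c] .
  \<comment> \<open>A zero pivot needs no separate elimination step: its row is zero already, so row
    \<open>c\<close> of \<open>A'\<close> below is zero for either kind of pivot.\<close>
  have row: "A c j = 0" if "A c c = 0" "j < p" for j
    by (rule psd_row_eq_0[OF sym psd c that])
  define A' where "A' = (\<lambda>i j. A i j - A c i * A c j / A c c)"
  have sym': "A' i j = A' j i" if "i < p" "j < p" for i j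
    using sym[OF that] by (simp add: A'_def mult_ac)
  have band1: "b i \<le> b c + m" if "i < p" "A c i \<noteq> 0" for i
    using band[OF c that(1)] that(2) by force
  have ge: "c \<le> i" if "i < p" "A c i \<noteq> 0" for i
    using zero[OF that(1) c] sym[OF that(1) c] that(2) by force
  \<comment> \<open>A nonzero correction at \<open>(i, j)\<close> would give
    \<open>b j \<le> b c + m\<close> and \<open>c \<le> i\<close>, hence
    \<open>b j \<le> b i + m\<close>.\<close>
  have band': "A' i j = 0" if "i < p" "j < p" "b i + m < b j" for i j
  proof -
    have "A c i * A c j = 0"
    proof (rule ccontr)
      assume "A c i * A c j \<noteq> 0"
      then have "b j \<le> b c + m" "c \<le> i" using band1 ge that by auto
      then show False using that(3) monoD[OF mono, of c i] by simp
    qed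
    then show ?thesis using band[OF that] by (simp add: A'_def)
  qed
  have zero': "A' i j = 0" if "i < p" "j < p" "i < Suc c" for i j
  proof (cases "i = c")
    case True
    then show ?thesis using row[OF _ that(2)] by (cases "A c c = 0") (auto simp: A'_def)
  next
    case False
    then have "i < c" using that by simp
    then have "A i j = 0" "A c i = 0" using zero[OF that(1,2)] ge[OF that(1)] by force+
    then show ?thesis by (simp add: A'_def)
  qed
  have "\<exists>V :: nat \<Rightarrow> nat \<Rightarrow> real. (\<forall>i<p. \<forall>j<p. A' i j = (\<Sum>k = Suc c..<p. V k i * V k j)) \<and>
     (\<forall>k i. V k i \<noteq> 0 \<longrightarrow> k \<le> i \<and> i < p \<and> b i \<le> b k + m)"
  proof (rule Suc.hyps(1))
    show "d = p - Suc c" "Suc c \<le> p" using Suc.hyps(2) by auto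
    show "0 \<le> quad_form p A' v" for v
      unfolding A'_def by (rule schur_complement_psd[OF sym psd c])
    show "A' i j = A' j i" if "i < p" "j < p" for i j by (rule sym'[OF that])
    show "A' i j = 0" if "i < p" "j < p" "b i + m < b j" for i j by (rule band'[OF that])
    show "A' i j = 0" if "i < p" "j < p" "i < Suc c" for i j by (rule zero'[OF that])
  qed
  then obtain V :: "nat \<Rightarrow> nat \<Rightarrow> real"
    where "\<forall>i<p. \<forall>j<p. A' i j = (\<Sum>k = Suc c..<p. V k i * V k j)"
      and "\<forall>k i. V k i \<noteq> 0 \<longrightarrow> k \<le> i \<and> i < p \<and> b i \<le> b k + m" by (elim exE conjE)
  note V = this(1)[rule_format] and supp = this(2)[rule_format]
  \<comment> \<open>Only column \<open>c\<close> is new, so the sum from \<open>Suc c\<close> on is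
    unchanged. Its products are \<open>A c i * A c j / A c c\<close> because the pivot is
    nonnegative; the guard \<open>i < p\<close> secures the support condition.\<close>
  define W where "W = V(c := \<lambda>i. if i < p then A c i / sqrt (A c c) else 0)"
  have "A i j = (\<Sum>k = c..<p. W k i * W k j)" if "i < p" "j < p" for i j
  proof -
    have "(\<Sum>k = c..<p. W k i * W k j) = W c i * W c j + (\<Sum>k = Suc c..<p. W k i * W k j)"
      using c by (rule sum.atLeast_Suc_lessThan)
    also have "(\<Sum>k = Suc c..<p. W k i * W k j) = A' i j"
      unfolding V[OF that] by (intro sum.cong) (auto simp: W_def)
    also have "W c i * W c j = A c i * A c j / A c c"
      using that pos by (simp add: W_def)
    finally show ?thesis by (simp add: A'_def)
  qed
  moreover have "k \<le> i \<and> i < p \<and> b i \<le> b k + m" if "W k i \<noteq> 0" for k i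
    using that supp[of k i] ge[of i] band1[of i] by (auto simp: W_def split: if_splits)
  ultimately show ?case by (intro exI[of _ W]) simp
qed

section \<open>Tools for the limit argument: compactness, block sums, entry bounds\<close>

text \<open>Bolzano-Weierstrass for finitely many coordinates, thinning the subsequence once per
  coordinate. The coordinates will be the entries of the averaged Gram matrices.\<close>

lemma bounded_family_convergent_subseq:
  fixes f :: "nat \<Rightarrow> 'i \<Rightarrow> real"
  assumes "finite S" and "\<And>n i. i \<in> S \<Longrightarrow> \<bar>f n i\<bar> \<le> B"
  shows "\<exists>r l. strict_mono r \<and> (\<forall>i\<in>S. (\<lambda>n. f (r n) i) \<longlonglongrightarrow> l i)"
  using assms
proof (induction S rule: finite_induct)
  case empty
  then show ?case using strict_mono_id by blast
next
  case (insert x S)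
  have "\<exists>r l. strict_mono r \<and> (\<forall>i\<in>S. (\<lambda>n. f (r n) i) \<longlonglongrightarrow> l i)"
    by (rule insert.IH) (use insert.prems in blast)
  then obtain r l where r: "strict_mono (r :: nat \<Rightarrow> nat)"
    and l: "\<And>i. i \<in> S \<Longrightarrow> (\<lambda>n. f (r n) i) \<longlonglongrightarrow> l i" by blast
  have "bounded (range (\<lambda>n. f (r n) x))"
    using insert.prems by (intro boundedI[of _ B]) auto
  then obtain y s where s: "strict_mono (s :: nat \<Rightarrow> nat)" and y: "((\<lambda>n. f (r n) x) \<circ> s) \<longlonglongrightarrow> y"
    using bounded_imp_convergent_subsequence by blast
  have "(\<lambda>n. f ((r \<circ> s) n) i) \<longlonglongrightarrow> (l(x := y)) i" if "i \<in> insert x S" for i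
    using LIMSEQ_subseq_LIMSEQ[OF l[of i] s] y that insert.hyps by (auto simp: o_def)
  then show ?case using strict_mono_o[OF r s] by blast
qed

lemma sum_blocks:
  fixes f :: "nat \<Rightarrow> 'a::comm_monoid_add"
  shows "(\<Sum>i<N * n. f i) = (\<Sum>j<N. \<Sum>a<n. f (j * n + a))"
proof -
  have "(\<Sum>a<n. f (j * n + a)) = sum f {j * n..<j * n + n}" for j
    using sum.shift_bounds_nat_ivl[of f 0 "j * n" n] by (simp add: lessThan_atLeast0 add.commute)
  then have "(\<Sum>j<N. \<Sum>a<n. f (j * n + a)) = (\<Sum>j<N. sum f {j * n..<j * n + n})" by simp
  also have "\<dots> = (\<Sum>i<N * n. f i)" by (rule sum.nat_group)
  finally show ?thesis by simp
qed

text \<open>Testing the form on \<open>e_j + e_i\<close> and \<open>e_j - e_i\<close> gives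
  \<open>2 * \<bar>A i j\<bar> \<le> A i i + A j j\<close>, and each diagonal entry is at most the
  trace. A bound on the traces thus bounds all entries.\<close>

lemma psd_entry_bound:
  assumes sym: "\<And>i j. i < p \<Longrightarrow> j < p \<Longrightarrow> A i j = A j i"
    and psd: "\<And>v. 0 \<le> quad_form p A v" and "i < p" "j < p"
  shows "\<bar>A i j\<bar> \<le> (\<Sum>k<p. A k k)"
proof -
  let ?e = "\<lambda>k. if k = j then 1 else 0"
  have nonneg: "0 \<le> A k k" if "k < p" for k using psd_diag_nonneg[OF psd that] .
  have le: "A k k \<le> (\<Sum>k<p. A k k)" if "k < p" for k
    by (rule member_le_sum) (use that nonneg in auto)
  have row: "(\<Sum>k<p. A i k * ?e k) = A i j" if "i < p" for i
    using assms(4) by (simp add: if_distrib[of "(*) _"] sum.delta cong: if_cong)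
  have "quad_form p A ?e = (\<Sum>i<p. (\<Sum>k<p. A i k * ?e k) * ?e i)"
    unfolding quad_form_def sum_distrib_right by (intro sum.cong refl) (simp only: mult_ac)
  also have "\<dots> = (\<Sum>i<p. if i = j then A i j else 0)"
    by (intro sum.cong refl) (simp add: row)
  also have "\<dots> = A j j" using assms(4) by (simp add: sum.delta)
  finally have "quad_form p A (\<lambda>k. ?e k + (if k = i then t else 0)) = A j j + 2 * t * A i j + t\<^sup>2 * A i i" for t
    using quad_form_add_unit[OF sym assms(3), where v = ?e and t = t] row[OF assms(3)] by simp
  then have "0 \<le> A j j + 2 * t * A i j + t\<^sup>2 * A i i" for t
    using psd[of "\<lambda>k. ?e k + (if k = i then t else 0)"] by simp
  from this[of 1] this[of "-1"] show ?thesis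
    using le[OF assms(3)] le[OF assms(4)] by (simp add: abs_le_iff)
qed

section \<open>Gram matrices of positive semidefinite pseudo-polynomials\<close>

text \<open>Orthogonality of the characters of the circle, the source of every coefficient
  extraction below.\<close>

lemma exp_int_has_integral:
  "((\<lambda>\<theta>. exp (\<i> * of_int k * of_real \<theta>)) has_integral (if k = 0 then of_real (2 * pi) else 0)) {-pi..pi}"
proof (cases "k = 0")
  case True
  then show ?thesis
    using has_integral_const_real[of "1::complex" "-pi" pi] by (simp add: scaleR_conv_of_real)
next
  case False
  let ?F = "\<lambda>\<theta>::real. exp (\<i> * of_int k * of_real \<theta>) / (\<i> * of_int k)"
  have "(?F has_vector_derivative exp (\<i> * of_int k * of_real \<theta>)) (at \<theta> within {-pi..pi})" for \<theta>
  proof -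
    have "((\<lambda>z. exp (\<i> * of_int k * z) / (\<i> * of_int k)) has_field_derivative
            exp (\<i> * of_int k * of_real \<theta>)) (at (of_real \<theta>))"
      using False by (auto intro!: derivative_eq_intros)
    from has_vector_derivative_real_field[OF this] show ?thesis
      by (rule has_vector_derivative_at_within)
  qed
  then have "((\<lambda>\<theta>. exp (\<i> * of_int k * of_real \<theta>)) has_integral (?F pi - ?F (-pi))) {-pi..pi}"
    by (intro fundamental_theorem_of_calculus) auto
  \<comment> \<open>The two exponents differ by \<open>2 * pi * \<i> * k\<close>, so the
    antiderivative has equal values at both ends.\<close>
  moreover have "exp (\<i> * of_int k * of_real pi) = exp (\<i> * of_int k * of_real (-pi))"
    unfolding exp_eq by (rule exI[of _ k]) (simp add: algebra_simps)
  ultimately show ?thesis using False by simp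
qed

section \<open>Entrywise forms of adjoints and positive semidefiniteness\<close>

lemma cscalar_prod_mult_mat_vec:
  assumes "A \<in> carrier_mat p p" "v \<in> carrier_vec p"
  shows "(A *\<^sub>v v) \<bullet>c v =
    (\<Sum>i<p. \<Sum>j<p. A $$ (i, j) * vec_index v j * conjugate (vec_index v i))"
proof -
  have "(A *\<^sub>v v) \<bullet>c v = (\<Sum>i<p. vec_index (A *\<^sub>v v) i * conjugate (vec_index v i))"
    using assms by (simp add: scalar_prod_def lessThan_atLeast0)
  also have "\<dots> = (\<Sum>i<p. (\<Sum>j<p. A $$ (i, j) * vec_index v j) * conjugate (vec_index v i))"
    using assms by (intro sum.cong) (simp_all add: scalar_prod_def lessThan_atLeast0)
  finally show ?thesis by (simp add: sum_distrib_right)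
qed

lemma index_mat_adjoint:
  assumes "A \<in> carrier_mat r c" "i < c" "j < r"
  shows "mat_adjoint A $$ (i, j) = conjugate (A $$ (j, i))"
  using assms by (simp add: mat_adjoint_def mat_of_rows_index)

lemma mat_adjoint_carrier: "A \<in> carrier_mat r c \<Longrightarrow> mat_adjoint A \<in> carrier_mat c r"
  by (simp add: mat_adjoint_def mat_of_rows_def)

lemma mat_adjoint_real: "mat_adjoint (A :: real mat) = transpose_mat A"
proof -
  have A: "A \<in> carrier_mat (dim_row A) (dim_col A)" by simp
  show ?thesis
    by (rule eq_matI)
      (use mat_adjoint_carrier[OF A] in \<open>auto simp: index_mat_adjoint[OF A]\<close>)
qed

lemma real_psd_iff:
  assumes "A \<in> sym_mats p"
  shows "psd A \<longleftrightarrow> (\<forall>v. 0 \<le> quad_form p (\<lambda>i j. A $$ (i, j)) v)"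
proof -
  have A: "A \<in> carrier_mat p p" "mat_adjoint A = A" "dim_row A = p"
    using assms by (auto simp: sym_mats_def mat_adjoint_real)
  have q: "(A *\<^sub>v v) \<bullet>c v = quad_form p (\<lambda>i j. A $$ (i, j)) (vec_index v)" if "v \<in> carrier_vec p" for v
    using cscalar_prod_mult_mat_vec[OF A(1) that] by (simp add: quad_form_def mult_ac)
  have "quad_form p (\<lambda>i j. A $$ (i, j)) (vec_index (Matrix.vec p v)) = quad_form p (\<lambda>i j. A $$ (i, j)) v" for v
    by (simp add: quad_form_def)
  then show ?thesis
    using A q by (auto simp: psd_def square_mat.simps) (metis vec_carrier)
qed

text \<open>An infinite matrix; finite sections arise from the summation range of
  \<open>quad_form\<close>. The block at \<open>(r, s)\<close> is \<open>Q (s - r)\<close>, matching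
  the blocks \<open>Y_{j,j+k}\<close> in \<open>D_map\<close>. The guard is needed because
  \<open>Q\<close> is arbitrary outside \<open>-m..m\<close>.\<close>

definition block_toeplitz :: "nat \<Rightarrow> nat \<Rightarrow> (int \<Rightarrow> real mat) \<Rightarrow> nat \<Rightarrow> nat \<Rightarrow> real" where
  "block_toeplitz n m Q i j =
     (if \<bar>int (j div n) - int (i div n)\<bar> \<le> int m
      then Q (int (j div n) - int (i div n)) $$ (i mod n, j mod n) else 0)"

lemma pseudo_poly_carrier: "pseudo_poly n m Q \<theta> \<in> carrier_mat n n"
  by (simp add: pseudo_poly_def)

lemma sum_mult_sum_mult_sum:
  fixes f :: "'a \<Rightarrow> 'd :: comm_semiring_0"
  shows "(\<Sum>k\<in>K. f k) * (\<Sum>j\<in>J. g j) * (\<Sum>i\<in>I. h i) = (\<Sum>k\<in>K. \<Sum>j\<in>J. \<Sum>i\<in>I. f k * g j * h i)"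
proof -
  have "(\<Sum>k\<in>K. f k) * (\<Sum>j\<in>J. g j) * (\<Sum>i\<in>I. h i)
      = (\<Sum>k\<in>K. f k) * (\<Sum>j\<in>J. \<Sum>i\<in>I. g j * h i)"
    by (simp only: mult.assoc sum_product[of g J h I])
  also have "\<dots> = (\<Sum>k\<in>K. \<Sum>j\<in>J. \<Sum>i\<in>I. f k * g j * h i)"
    by (subst sum_distrib_right) (simp only: sum_distrib_left mult.assoc)
  finally show ?thesis .
qed

text \<open>For the trigonometric polynomial \<open>w\<close> whose coefficient vectors are the
  blocks of \<open>v\<close>, the nonnegative function \<open>w^* \<Psi> w\<close> integrates to
  \<open>2 * pi\<close> times the Toeplitz form at \<open>v\<close>: orthogonality keeps exactly the
  terms with \<open>k = j - i\<close>.\<close>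

lemma block_toeplitz_psd:
  assumes psd: "circle_psd (pseudo_poly n m Q)"
  shows "0 \<le> quad_form (N * n) (block_toeplitz n m Q) v"
proof -
  define w where "w \<theta> b = (\<Sum>j<N. exp (\<i> * of_int (int j) * of_real \<theta>) * complex_of_real (v (j * n + b)))"
    for \<theta> :: real and b
  define x where "x k j i a b = Q k $$ (a, b) * v (j * n + b) * v (i * n + a)" for k j i a b
  define F where "F \<theta> = (\<Sum>a<n. \<Sum>b<n. pseudo_poly n m Q \<theta> $$ (a, b) * w \<theta> b * cnj (w \<theta> a))" for \<theta>
  define T where "T = (\<Sum>a<n. \<Sum>b<n. \<Sum>k = - int m..int m. \<Sum>j<N. \<Sum>i<N.
      (if int j - int i - k = 0 then of_real (2 * pi) else 0) * complex_of_real (x k j i a b))"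
  have pos: "0 \<le> F \<theta>" if "\<theta> \<in> {-pi..pi}" for \<theta>
  proof -
    have "psd (pseudo_poly n m Q \<theta>)" using psd that by (simp add: circle_psd_def)
    then have "0 \<le> (pseudo_poly n m Q \<theta> *\<^sub>v Matrix.vec n (w \<theta>)) \<bullet>c Matrix.vec n (w \<theta>)"
      using pseudo_poly_carrier[of n m Q \<theta>] by (auto simp: psd_def)
    also have "\<dots> = F \<theta>"
      by (subst cscalar_prod_mult_mat_vec[OF pseudo_poly_carrier]) (auto simp: F_def)
    finally show ?thesis .
  qed
  have "F \<theta> = (\<Sum>a<n. \<Sum>b<n. \<Sum>k = - int m..int m. \<Sum>j<N. \<Sum>i<N.
      exp (\<i> * of_int (int j - int i - k) * of_real \<theta>) * complex_of_real (x k j i a b))" for \<theta>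
    unfolding F_def
  proof (intro sum.cong refl)
    fix a b assume ab: "a \<in> {..<n}" "b \<in> {..<n}"
    have "cnj (w \<theta> a) = (\<Sum>i<N. exp (- (\<i> * of_int (int i) * of_real \<theta>)) * complex_of_real (v (i * n + a)))"
      by (simp add: w_def cnj_sum exp_cnj)
    moreover have "exp (- (\<i> * of_int k * of_real \<theta>)) * q * (exp (\<i> * of_int (int j) * of_real \<theta>) * r)
        * (exp (- (\<i> * of_int (int i) * of_real \<theta>)) * s)
        = exp (\<i> * of_int (int j - int i - k) * of_real \<theta>) * (q * r * s)" for k j i and q r s :: complex
    proof -
      have "\<i> * of_int (int j - int i - k) * of_real \<theta>
        = - (\<i> * of_int k * of_real \<theta>) + \<i> * of_int (int j) * of_real \<theta> + - (\<i> * of_int (int i) * of_real \<theta>)"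
        by (simp add: algebra_simps)
      then show ?thesis by (simp only: exp_add mult_ac)
    qed
    ultimately show "pseudo_poly n m Q \<theta> $$ (a, b) * w \<theta> b * cnj (w \<theta> a) =
      (\<Sum>k = - int m..int m. \<Sum>j<N. \<Sum>i<N.
      exp (\<i> * of_int (int j - int i - k) * of_real \<theta>) * complex_of_real (x k j i a b))"
      using ab unfolding w_def
      by (simp only: sum_mult_sum_mult_sum pseudo_poly_def x_def index_mat lessThan_iff prod.case of_real_mult)
  qed
  then have "F = (\<lambda>\<theta>. \<Sum>a<n. \<Sum>b<n. \<Sum>k = - int m..int m. \<Sum>j<N. \<Sum>i<N.
      exp (\<i> * of_int (int j - int i - k) * of_real \<theta>) * complex_of_real (x k j i a b))" by (rule ext)
  then have "(F has_integral T) {-pi..pi}"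
    unfolding T_def by (simp only:)
      (intro has_integral_sum has_integral_mult_left exp_int_has_integral
        finite_lessThan finite_atLeastAtMost_int)
  \<comment> \<open>In the complex order \<open>0 \<le> F \<theta>\<close> says that the value is
    real and nonnegative, so passing to real parts loses nothing.\<close>
  from has_integral_linear[OF this bounded_linear_Re]
  have "0 \<le> Re T"
    by (rule has_integral_nonneg) (use pos in \<open>auto simp: less_eq_complex_def\<close>)
  also have "T = of_real (2 * pi * (\<Sum>a<n. \<Sum>b<n. \<Sum>j<N. \<Sum>i<N.
      if \<bar>int j - int i\<bar> \<le> int m then x (int j - int i) j i a b else 0))"
  proof -
    \<comment> \<open>At most the index \<open>k = j - i\<close> survives, and it lies in the range
      only within the band; this produces the guard of \<open>block_toeplitz\<close>.\<close>
    have "(\<Sum>k = - int m..int m. (if int j - int i - k = 0 then of_real (2 * pi) else 0) * complex_of_real (x k j i a b))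
       = of_real (2 * pi * (if \<bar>int j - int i\<bar> \<le> int m then x (int j - int i) j i a b else 0))" for a b j i
    proof -
      have "(\<Sum>k = - int m..int m. (if int j - int i - k = 0 then of_real (2 * pi) else 0) * complex_of_real (x k j i a b))
        = (\<Sum>k = - int m..int m. if k = int j - int i then of_real (2 * pi * x k j i a b) else 0)"
        by (intro sum.cong) auto
      then show ?thesis by (simp add: sum.delta abs_le_iff)
    qed
    moreover have "T = (\<Sum>a<n. \<Sum>b<n. \<Sum>j<N. \<Sum>i<N. \<Sum>k = - int m..int m.
      (if int j - int i - k = 0 then of_real (2 * pi) else 0) * complex_of_real (x k j i a b))"
      unfolding T_def
      by (intro sum.cong refl, subst sum.swap, intro sum.cong refl, rule sum.swap)
    ultimately show ?thesis by (simp only: of_real_sum sum_distrib_left)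
  qed
  also have "(\<Sum>a<n. \<Sum>b<n. \<Sum>j<N. \<Sum>i<N.
      if \<bar>int j - int i\<bar> \<le> int m then x (int j - int i) j i a b else 0)
     = quad_form (N * n) (block_toeplitz n m Q) v"
  proof -
    have "quad_form (N * n) (block_toeplitz n m Q) v
      = (\<Sum>i<N. \<Sum>a<n. \<Sum>j<N. \<Sum>b<n. if \<bar>int j - int i\<bar> \<le> int m then x (int j - int i) j i a b else 0)"
      unfolding quad_form_def sum_blocks
      by (intro sum.cong refl) (auto simp: block_toeplitz_def x_def mult_ac)
    also have "\<dots> = (\<Sum>a<n. \<Sum>i<N. \<Sum>b<n. \<Sum>j<N. if \<bar>int j - int i\<bar> \<le> int m then x (int j - int i) j i a b else 0)"
      by (subst sum.swap, rule sum.cong[OF refl], rule sum.cong[OF refl], rule sum.swap)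
    also have "\<dots> = (\<Sum>a<n. \<Sum>b<n. \<Sum>j<N. \<Sum>i<N. if \<bar>int j - int i\<bar> \<le> int m then x (int j - int i) j i a b else 0)"
      by (rule sum.cong[OF refl], subst sum.swap, rule sum.cong[OF refl], rule sum.swap)
    finally show ?thesis ..
  qed
  finally show ?thesis using pi_gt_zero by (auto simp: zero_le_mult_iff)
qed

text \<open>Block diagonal \<open>k\<close> of a section with \<open>Suc N\<close> block rows holds
  \<open>Suc N - k\<close> copies of \<open>Q (int k)\<close>. Moving a window along the block
  diagonal preserves differences of block indices, so this total survives the shift to the origin;
  dividing by \<open>Suc N\<close> gives the stated factor.\<close>

lemma gram_average:
  assumes Q: "coeff_family n m Q" and psd: "circle_psd (pseudo_poly n m Q)" and "n \<ge> 1" "m \<le> N"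
  shows "\<exists>Y. (\<forall>s t. Y s t = Y t s) \<and> (\<forall>p v. 0 \<le> quad_form p Y v) \<and>
     (\<forall>k\<le>m. \<forall>a<n. \<forall>b<n. (\<Sum>j = 0..m - k. Y (j * n + a) ((j + k) * n + b))
         = real (Suc N - k) / real (Suc N) * Q (int k) $$ (a, b))"
proof -
  let ?p = "Suc N * n" and ?T = "block_toeplitz n m Q"
  have "mono (\<lambda>i::nat. i div n)" by (simp add: mono_def div_le_mono)
  moreover have "?T i j = ?T j i" for i j
  proof (cases "\<bar>int (j div n) - int (i div n)\<bar> \<le> int m")
    case True
    define k where "k = int (j div n) - int (i div n)"
    have "k \<in> {- int m..int m}" "- k \<in> {- int m..int m}" using True by (auto simp: k_def)
    then have "Q k = transpose_mat (Q (- k))" "Q (- k) \<in> carrier_mat n n"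
      using Q unfolding coeff_family_def by blast+
    moreover have "i mod n < n" "j mod n < n" using \<open>n \<ge> 1\<close> by auto
    ultimately have "Q k $$ (i mod n, j mod n) = Q (- k) $$ (j mod n, i mod n)"
      by (metis carrier_matD index_transpose_mat(1))
    then show ?thesis using True by (simp add: block_toeplitz_def k_def abs_minus_commute)
  qed (simp add: block_toeplitz_def abs_minus_commute)
  moreover have "0 \<le> quad_form ?p ?T v" for v by (rule block_toeplitz_psd[OF psd])
  moreover have "?T i j = 0" if "i div n + m < j div n" for i j
    using that by (simp add: block_toeplitz_def)
  \<comment> \<open>Elimination starts at \<open>c = 0\<close>, where the requirement of cleared
    rows is vacuous; \<open>b\<close> is division by \<open>n\<close>.\<close>
  ultimately have "\<exists>V :: nat \<Rightarrow> nat \<Rightarrow> real. (\<forall>i<?p. \<forall>j<?p. ?T i j = (\<Sum>k = 0..<?p. V k i * V k j)) \<and>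
     (\<forall>k i. V k i \<noteq> 0 \<longrightarrow> k \<le> i \<and> i < ?p \<and> i div n \<le> k div n + m)"
    by (intro banded_cholesky_from) auto
  then obtain V :: "nat \<Rightarrow> nat \<Rightarrow> real"
    where "\<forall>i<?p. \<forall>j<?p. ?T i j = (\<Sum>k = 0..<?p. V k i * V k j)"
      and "\<forall>k i. V k i \<noteq> 0 \<longrightarrow> k \<le> i \<and> i < ?p \<and> i div n \<le> k div n + m"
    by (elim exE conjE)
  note V = this(1)[rule_format] and supp = this(2)[rule_format]
  \<comment> \<open>Column \<open>c\<close> of the factor lives in the block rows \<open>c div n, \<dots>, c div n + m\<close>; \<open>y c\<close> is its shift to the block rows \<open>0, \<dots>, m\<close>.\<close>
  define y where "y c s = V c (s + (c div n) * n)" for c s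
  define Y where "Y s t = (\<Sum>c = 0..<?p. y c s * y c t) / real (Suc N)" for s t
  have sym: "Y s t = Y t s" for s t by (simp add: Y_def mult.commute)
  have nonneg: "0 \<le> quad_form p Y v" for p v
  proof -
    have "quad_form p Y v = (\<Sum>i<p. \<Sum>j<p. \<Sum>c = 0..<?p. (y c i * v i) * (y c j * v j)) / real (Suc N)"
      unfolding quad_form_def Y_def by (simp add: sum_divide_distrib sum_distrib_right sum_distrib_left mult_ac)
    also have "(\<Sum>i<p. \<Sum>j<p. \<Sum>c = 0..<?p. (y c i * v i) * (y c j * v j))
       = (\<Sum>c = 0..<?p. \<Sum>i<p. \<Sum>j<p. (y c i * v i) * (y c j * v j))"
      by (rule trans[OF sum.cong[OF refl sum.swap] sum.swap])
    also have "\<dots> = (\<Sum>c = 0..<?p. (\<Sum>i<p. y c i * v i)\<^sup>2)"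
      by (simp only: power2_eq_square sum_product)
    finally show ?thesis by (simp add: sum_nonneg)
  qed
  have D: "(\<Sum>j = 0..m - k. Y (j * n + a) ((j + k) * n + b))
         = real (Suc N - k) / real (Suc N) * Q (int k) $$ (a, b)"
    if "k \<le> m" "a < n" "b < n" for k a b
  proof -
    \<comment> \<open>The substitution is \<open>i = j + c div n\<close>. The two ranges need not
      correspond, so the bijection is only between the nonzero terms; the support of column
      \<open>c\<close> locates these.\<close>
    have shift: "(\<Sum>j = 0..m - k. y c (j * n + a) * y c ((j + k) * n + b))
       = (\<Sum>i<Suc N - k. V c (i * n + a) * V c ((i + k) * n + b))" for c
    proof (rule sum.reindex_bij_witness_not_neutral
        [where S' = "{j \<in> {0..m - k}. y c (j * n + a) * y c ((j + k) * n + b) = 0}"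
          and T' = "{i \<in> {..<Suc N - k}. V c (i * n + a) * V c ((i + k) * n + b) = 0}"
          and i = "\<lambda>i. i - c div n" and j = "\<lambda>j. j + c div n"])
      \<comment> \<open>The second factor is nonzero, so its index lies below \<open>?p\<close>,
        which forces \<open>j + c div n + k < Suc N\<close>.\<close>
      fix j assume j: "j \<in> {0..m - k} - {j \<in> {0..m - k}. y c (j * n + a) * y c ((j + k) * n + b) = 0}"
      then have "V c ((j + k) * n + b + (c div n) * n) \<noteq> 0" by (auto simp: y_def)
      moreover have e: "(j + k) * n + b + (c div n) * n = (j + k + c div n) * n + b"
        "j * n + a + (c div n) * n = (j + c div n) * n + a" for j by (simp_all add: algebra_simps)
      ultimately have "(j + k + c div n) * n + b < Suc N * n" using supp by metis
      then have "((j + k + c div n) * n + b) div n < Suc N"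
        by (metis less_mult_imp_div_less)
      then have "j + c div n < Suc N - k" using that by simp
      then show "j + c div n \<in> {..<Suc N - k} - {i \<in> {..<Suc N - k}. V c (i * n + a) * V c ((i + k) * n + b) = 0}"
        using j e by (auto simp: y_def algebra_simps)
    next
      \<comment> \<open>Conversely, the first factor gives \<open>c div n \<le> i\<close> (the
        window has begun) and the second gives \<open>i + k \<le> c div n + m\<close> (it has not
        ended).\<close>
      fix i assume i: "i \<in> {..<Suc N - k} - {i \<in> {..<Suc N - k}. V c (i * n + a) * V c ((i + k) * n + b) = 0}"
      then have "V c (i * n + a) \<noteq> 0" "V c ((i + k) * n + b) \<noteq> 0" by auto
      then have "c \<le> i * n + a" "((i + k) * n + b) div n \<le> c div n + m" using supp by blast+
      then have le: "c div n \<le> i" "i + k \<le> c div n + m"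
        using div_le_mono[of c "i * n + a" n] that by simp_all
      then obtain d where "i = d + c div n" by (metis le_iff_add add.commute)
      then have e: "i * n + a = (i - c div n) * n + a + (c div n) * n"
        "(i + k) * n + b = (i - c div n + k) * n + b + (c div n) * n"
        by (simp_all add: algebra_simps)
      show "i - c div n \<in> {0..m - k} - {j \<in> {0..m - k}. y c (j * n + a) * y c ((j + k) * n + b) = 0}"
        using i le e by (auto simp: y_def)
      show "i - c div n + c div n = i" using le by simp
    next
      fix j
      show "V c ((j + c div n) * n + a) * V c ((j + c div n + k) * n + b) = y c (j * n + a) * y c ((j + k) * n + b)"
        by (simp add: y_def algebra_simps)
    qed auto
    have "(\<Sum>j = 0..m - k. Y (j * n + a) ((j + k) * n + b))
       = (\<Sum>c = 0..<?p. \<Sum>j = 0..m - k. y c (j * n + a) * y c ((j + k) * n + b)) / real (Suc N)"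
      unfolding Y_def sum_divide_distrib[symmetric] by (subst sum.swap) (rule refl)
    also have "\<dots> = (\<Sum>i<Suc N - k. \<Sum>c = 0..<?p. V c (i * n + a) * V c ((i + k) * n + b)) / real (Suc N)"
      unfolding shift by (subst sum.swap) (rule refl)
    \<comment> \<open>Summing over \<open>c\<close> first restores the Cholesky product, that is,
      the Toeplitz entry, which does not depend on \<open>i\<close>.\<close>
    also have "(\<Sum>i<Suc N - k. \<Sum>c = 0..<?p. V c (i * n + a) * V c ((i + k) * n + b))
       = (\<Sum>i<Suc N - k. Q (int k) $$ (a, b))"
    proof (intro sum.cong refl)
      fix i assume "i \<in> {..<Suc N - k}"
      then have "Suc i \<le> Suc N" "Suc (i + k) \<le> Suc N" by auto
      then have "Suc i * n \<le> ?p" "Suc (i + k) * n \<le> ?p" using mult_le_mono1 by blast+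
      moreover have "i * n + a < Suc i * n" "(i + k) * n + b < Suc (i + k) * n" using that by auto
      ultimately have "i * n + a < ?p" "(i + k) * n + b < ?p" by (meson order.strict_trans2)+
      then have "(\<Sum>c = 0..<?p. V c (i * n + a) * V c ((i + k) * n + b)) = ?T (i * n + a) ((i + k) * n + b)"
        by (rule V[symmetric])
      also have "\<dots> = Q (int k) $$ (a, b)" using that by (simp add: block_toeplitz_def)
      finally show "(\<Sum>c = 0..<?p. V c (i * n + a) * V c ((i + k) * n + b)) = Q (int k) $$ (a, b)" .
    qed
    finally show ?thesis by simp
  qed
  show ?thesis using sym nonneg D by (intro exI[of _ Y]) blast
qed

section \<open>The limiting Gram matrix\<close>

lemma D_map_index:
  assumes "a < n" "b < n"
  shows "D_map n m k Y $$ (a, b) = (\<Sum>j = 0..m - k. Y $$ (j * n + a, (j + k) * n + b))"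
  using assms by (simp add: D_map_def block_def)

lemma D_map_carrier: "D_map n m k Y \<in> carrier_mat n n"
  by (simp add: D_map_def)

lemma block_index_less:
  fixes a j m n :: nat
  assumes "j \<le> m" "a < n"
  shows "j * n + a < n * (m + 1)"
proof -
  have "j * n + a < Suc j * n" using assms by simp
  also have "\<dots> \<le> n * (m + 1)" using mult_le_mono1[of "Suc j" "m + 1" n] assms by (simp add: mult.commute)
  finally show ?thesis .
qed

lemma sym_mats_index:
  assumes "Y \<in> sym_mats p" "s < p" "t < p"
  shows "Y $$ (s, t) = Y $$ (t, s)"
proof -
  have "transpose_mat Y = Y" "Y \<in> carrier_mat p p" using assms by (auto simp: sym_mats_def)
  then show ?thesis using assms index_transpose_mat(1)[of s Y t] by auto
qed

text \<open>The Gram-matrix form of the matrix Fejer-Riesz theorem, with a real Gram matrix. The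
  averages have equal traces, hence lie in a compact set, and their factors tend to 1 for each fixed
  \<open>k\<close>; symmetry, positivity and the linear equations pass to the limit.\<close>

lemma psd_gram_matrix_exists:
  assumes Q: "coeff_family n m Q" and psd: "circle_psd (pseudo_poly n m Q)" and "n \<ge> 1"
  shows "\<exists>Y \<in> sym_mats (n * (m + 1)). psd Y \<and> (\<forall>k\<le>m. D_map n m k Y = Q (int k))"
proof -
  let ?p = "n * (m + 1)"
  \<comment> \<open>The section size is offset by \<open>m\<close>, so that
    \<open>gram_average\<close> applies for every \<open>N\<close>.\<close>
  let ?c = "\<lambda>N k. real (Suc (N + m) - k) / real (Suc (N + m))"
  have ex: "\<forall>N. \<exists>Y. (\<forall>s t. Y s t = Y t s) \<and> (\<forall>p v. 0 \<le> quad_form p Y v) \<and>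
     (\<forall>k\<le>m. \<forall>a<n. \<forall>b<n. (\<Sum>j = 0..m - k. Y (j * n + a) ((j + k) * n + b))
         = ?c N k * Q (int k) $$ (a, b))"
    by (intro allI gram_average[OF assms]) simp
  from choice[OF ex]
  obtain Y where Y: "\<forall>N. (\<forall>s t. Y N s t = Y N t s) \<and> (\<forall>p v. 0 \<le> quad_form p (Y N) v) \<and>
     (\<forall>k\<le>m. \<forall>a<n. \<forall>b<n. (\<Sum>j = 0..m - k. Y N (j * n + a) ((j + k) * n + b))
         = ?c N k * Q (int k) $$ (a, b))" by (elim exE)
  have sym: "Y N s t = Y N t s" and nonneg: "0 \<le> quad_form p (Y N) v" for N s t p v
    using Y by auto
  have D: "(\<Sum>j = 0..m - k. Y N (j * n + a) ((j + k) * n + b)) = ?c N k * Q (int k) $$ (a, b)"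
    if "k \<le> m" "a < n" "b < n" for N k a b
    using Y that by blast
  \<comment> \<open>For \<open>k = 0\<close> the factor \<open>?c N 0\<close> is 1, so every
    \<open>Y N\<close> has this same trace.\<close>
  define B where "B = (\<Sum>a<n. Q 0 $$ (a, a))"
  have "\<bar>Y N s t\<bar> \<le> B" if "s < ?p" "t < ?p" for N s t
  proof -
    have "\<bar>Y N s t\<bar> \<le> (\<Sum>k<?p. Y N k k)"
      by (rule psd_entry_bound[OF sym nonneg that])
    also have "\<dots> = (\<Sum>k<Suc m * n. Y N k k)" by (simp add: mult.commute)
    also have "\<dots> = (\<Sum>a<n. \<Sum>j = 0..m. Y N (j * n + a) (j * n + a))"
      unfolding sum_blocks by (subst sum.swap) (simp add: lessThan_Suc_atMost atMost_atLeast0)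
    also have "\<dots> = B" unfolding B_def using D[of 0] by (intro sum.cong) auto
    finally show ?thesis .
  qed
  then have "\<exists>r l. strict_mono r \<and> (\<forall>i\<in>{..<?p} \<times> {..<?p}. (\<lambda>N. case i of (s, t) \<Rightarrow> Y (r N) s t) \<longlonglongrightarrow> l i)"
    by (intro bounded_family_convergent_subseq[where f = "\<lambda>N (s, t). Y N s t" and B = B]) auto
  then obtain r l where r: "strict_mono (r :: nat \<Rightarrow> nat)"
    and "\<forall>i\<in>{..<?p} \<times> {..<?p}. (\<lambda>N. case i of (s, t) \<Rightarrow> Y (r N) s t) \<longlonglongrightarrow> l i" by (elim exE conjE)
  then have l: "(\<lambda>N. Y (r N) s t) \<longlonglongrightarrow> l (s, t)" if "s < ?p" "t < ?p" for s t
    using that by fastforce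
  define Z where "Z = Matrix.mat ?p ?p l"
  have "l (s, t) = l (t, s)" if "s < ?p" "t < ?p" for s t
    by (rule LIMSEQ_unique[OF l[OF that]], subst sym) (rule l[OF that(2,1)])
  then have Z: "Z \<in> sym_mats ?p"
    by (auto simp: sym_mats_def Z_def intro!: eq_matI)
  moreover have "psd Z"
    unfolding real_psd_iff[OF Z]
  proof
    fix v
    have "(\<lambda>N. quad_form ?p (Y (r N)) v) \<longlonglongrightarrow> quad_form ?p (\<lambda>i j. Z $$ (i, j)) v"
      unfolding quad_form_def by (intro tendsto_intros) (auto simp: Z_def l)
    then show "0 \<le> quad_form ?p (\<lambda>i j. Z $$ (i, j)) v"
      by (rule LIMSEQ_le_const) (use nonneg in auto)
  qed
  moreover have "D_map n m k Z = Q (int k)" if "k \<le> m" for k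
  proof (rule eq_matI)
    have "int k \<in> {- int m..int m}" using that by auto
    then have "Q (int k) \<in> carrier_mat n n" using Q unfolding coeff_family_def by blast
    then show dims: "dim_row (D_map n m k Z) = dim_row (Q (int k))" "dim_col (D_map n m k Z) = dim_col (Q (int k))"
      by (auto simp: D_map_def)
    fix a b assume "a < dim_row (Q (int k))" "b < dim_col (Q (int k))"
    then have ab: "a < n" "b < n" using \<open>Q (int k) \<in> carrier_mat n n\<close> by auto
    have "(\<lambda>N. ?c N k * Q (int k) $$ (a, b)) \<longlonglongrightarrow> 1 * Q (int k) $$ (a, b)"
    proof (rule tendsto_mult_right)
      have "(\<lambda>N. 1 - real k * inverse (real (Suc (N + m)))) \<longlonglongrightarrow> 1 - real k * 0"
        by (intro tendsto_intros LIMSEQ_ignore_initial_segment LIMSEQ_inverse_real_of_nat)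
      \<comment> \<open>Here \<open>k \<le> m\<close> makes the truncated subtraction in
        \<open>?c\<close> exact.\<close>
      moreover have "1 - real k * inverse (real (Suc (N + m))) = ?c N k" for N
        using that by (simp add: of_nat_diff field_simps)
      ultimately show "(\<lambda>N. ?c N k) \<longlonglongrightarrow> 1" by simp
    qed
    then have "((\<lambda>N. ?c N k * Q (int k) $$ (a, b)) \<circ> r) \<longlonglongrightarrow> Q (int k) $$ (a, b)"
      using LIMSEQ_subseq_LIMSEQ[OF _ r] by fastforce
    moreover have "((\<lambda>N. ?c N k * Q (int k) $$ (a, b)) \<circ> r)
       = (\<lambda>N. \<Sum>j = 0..m - k. Y (r N) (j * n + a) ((j + k) * n + b))"
      using D[OF that ab] by (simp add: fun_eq_iff)
    moreover have "(\<lambda>N. \<Sum>j = 0..m - k. Y (r N) (j * n + a) ((j + k) * n + b)) \<longlonglongrightarrow> D_map n m k Z $$ (a, b)"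
      unfolding D_map_index[OF ab]
    proof (rule tendsto_sum)
      fix j assume "j \<in> {0..m - k}"
      then have "j * n + a < ?p" "(j + k) * n + b < ?p"
        using that ab by (intro block_index_less; simp)+
      then show "(\<lambda>N. Y (r N) (j * n + a) ((j + k) * n + b)) \<longlonglongrightarrow> Z $$ (j * n + a, (j + k) * n + b)"
        using l by (simp add: Z_def)
    qed
    ultimately show "D_map n m k Z $$ (a, b) = Q (int k) $$ (a, b)"
      using LIMSEQ_unique by simp
  qed
  ultimately show ?thesis by blast
qed

section \<open>Fourier coefficients\<close>

text \<open>Extends \<open>D_map\<close> to negative \<open>k\<close>. Summing over all block pairs
  with an indicator avoids a case distinction on the sign of \<open>k\<close>.\<close>

definition gram_coeff :: "nat \<Rightarrow> nat \<Rightarrow> real mat \<Rightarrow> int \<Rightarrow> real mat" where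
  "gram_coeff n m Y k = Matrix.mat n n (\<lambda>(a, b).
     \<Sum>j\<le>m. \<Sum>l\<le>m. if int l - int j = k then Y $$ (j * n + a, l * n + b) else 0)"

lemma D_map_eq_gram_coeff:
  assumes "k \<le> m"
  shows "D_map n m k Y = gram_coeff n m Y (int k)"
proof (rule eq_matI)
  fix a b assume "a < dim_row (gram_coeff n m Y (int k))" "b < dim_col (gram_coeff n m Y (int k))"
  then have ab: "a < n" "b < n" by (auto simp: gram_coeff_def)
  have "(\<Sum>l\<le>m. if int l - int j = int k then Y $$ (j * n + a, l * n + b) else 0)
      = (if j \<le> m - k then Y $$ (j * n + a, (j + k) * n + b) else 0)" for j
  proof -
    have "(\<Sum>l\<le>m. if int l - int j = int k then Y $$ (j * n + a, l * n + b) else 0)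
      = (\<Sum>l\<le>m. if l = j + k then Y $$ (j * n + a, l * n + b) else 0)"
      by (intro sum.cong) auto
    also have "\<dots> = (if j + k \<le> m then Y $$ (j * n + a, (j + k) * n + b) else 0)"
      by (simp add: sum.delta)
    finally show ?thesis using assms by (simp add: le_diff_conv2)
  qed
  then have "gram_coeff n m Y (int k) $$ (a, b)
    = (\<Sum>j\<le>m. if j \<le> m - k then Y $$ (j * n + a, (j + k) * n + b) else 0)"
    using ab by (simp add: gram_coeff_def)
  also have "\<dots> = (\<Sum>j = 0..m - k. Y $$ (j * n + a, (j + k) * n + b))"
    by (rule sum.mono_neutral_cong_right) auto
  finally show "D_map n m k Y $$ (a, b) = gram_coeff n m Y (int k) $$ (a, b)"
    by (simp add: D_map_index[OF ab])
qed (auto simp: D_map_def gram_coeff_def)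

text \<open>Symmetry of \<open>Y\<close> exchanges the blocks with index difference \<open>k\<close>
  and the transposes of those with difference \<open>- k\<close>.\<close>

lemma gram_coeff_family:
  assumes "Y \<in> sym_mats (n * (m + 1))"
  shows "coeff_family n m (gram_coeff n m Y)"
proof -
  have "gram_coeff n m Y k = transpose_mat (gram_coeff n m Y (- k))" for k
  proof (rule eq_matI)
    fix a b assume "a < dim_row (transpose_mat (gram_coeff n m Y (- k)))"
      "b < dim_col (transpose_mat (gram_coeff n m Y (- k)))"
    then have ab: "a < n" "b < n" by (auto simp: gram_coeff_def)
    have "(\<Sum>j\<le>m. \<Sum>l\<le>m. if int l - int j = k then Y $$ (j * n + a, l * n + b) else 0)
        = (\<Sum>l\<le>m. \<Sum>j\<le>m. if int l - int j = k then Y $$ (j * n + a, l * n + b) else 0)"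
      by (rule sum.swap)
    also have "\<dots> = (\<Sum>j\<le>m. \<Sum>l\<le>m. if int l - int j = - k then Y $$ (j * n + b, l * n + a) else 0)"
    proof (intro sum.cong refl)
      fix j l assume "j \<in> {..m}" "l \<in> {..m}"
      then have "Y $$ (l * n + a, j * n + b) = Y $$ (j * n + b, l * n + a)"
        using ab by (intro sym_mats_index[OF assms] block_index_less) auto
      then show "(if int j - int l = k then Y $$ (l * n + a, j * n + b) else 0)
        = (if int l - int j = - k then Y $$ (j * n + b, l * n + a) else 0)" by auto
    qed
    finally show "gram_coeff n m Y k $$ (a, b) = transpose_mat (gram_coeff n m Y (- k)) $$ (a, b)"
      using ab by (simp add: gram_coeff_def)
  qed (auto simp: gram_coeff_def)
  moreover have "gram_coeff n m Y k \<in> carrier_mat n n" for k by (simp add: gram_coeff_def)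
  ultimately show ?thesis unfolding coeff_family_def by blast
qed

section \<open>Values of the sandwiched Gram matrix\<close>

lemma shift_op_carrier: "shift_op n m \<theta> \<in> carrier_mat n (n * (m + 1))"
  by (simp add: shift_op_def)

lemma sandwich_carrier: "sandwich n m Y \<theta> \<in> carrier_mat n n"
  using mat_adjoint_carrier[OF shift_op_carrier] shift_op_carrier unfolding sandwich_def
  by (metis carrier_matD carrier_matI index_mult_mat(2,3))

lemma sandwich_index:
  assumes Y: "Y \<in> carrier_mat (n * (m + 1)) (n * (m + 1))" and ab: "a < n" "b < n"
  shows "sandwich n m Y \<theta> $$ (a, b) = (\<Sum>s<n * (m + 1). \<Sum>t<n * (m + 1).
    shift_op n m \<theta> $$ (a, s) * of_real (Y $$ (s, t)) * cnj (shift_op n m \<theta> $$ (b, t)))"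
proof -
  let ?p = "n * (m + 1)" and ?S = "shift_op n m \<theta>"
  note S = shift_op_carrier[of n m \<theta>] and S' = mat_adjoint_carrier[OF shift_op_carrier[of n m \<theta>]]
  have SY: "?S * map_mat of_real Y \<in> carrier_mat n ?p" using S Y by auto
  have "sandwich n m Y \<theta> $$ (a, b)
      = (\<Sum>t<?p. (?S * map_mat of_real Y) $$ (a, t) * mat_adjoint ?S $$ (t, b))"
    using SY S' ab unfolding sandwich_def
    by (subst index_mult_mat) (auto simp: scalar_prod_def lessThan_atLeast0 simp del: index_mult_mat)
  also have "\<dots> = (\<Sum>t<?p. (\<Sum>s<?p. ?S $$ (a, s) * of_real (Y $$ (s, t))) * cnj (?S $$ (b, t)))"
  proof (intro sum.cong refl)
    fix t assume t: "t \<in> {..<?p}"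
    have "(?S * map_mat of_real Y) $$ (a, t) = (\<Sum>s<?p. ?S $$ (a, s) * of_real (Y $$ (s, t)))"
      using S Y ab t by (subst index_mult_mat) (auto simp: scalar_prod_def lessThan_atLeast0)
    moreover have "mat_adjoint ?S $$ (t, b) = cnj (?S $$ (b, t))"
      using index_mat_adjoint[OF S, of t b] ab t by simp
    ultimately show "(?S * map_mat of_real Y) $$ (a, t) * mat_adjoint ?S $$ (t, b)
      = (\<Sum>s<?p. ?S $$ (a, s) * of_real (Y $$ (s, t))) * cnj (?S $$ (b, t))" by simp
  qed
  also have "\<dots> = (\<Sum>s<?p. \<Sum>t<?p. ?S $$ (a, s) * of_real (Y $$ (s, t)) * cnj (?S $$ (b, t)))"
    unfolding sum_distrib_right by (rule sum.swap)
  finally show ?thesis .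
qed

text \<open>Block \<open>(j, l)\<close> enters with the factor \<open>exp (\<i> j \<theta>)\<close>
  times the conjugate of \<open>exp (\<i> l \<theta>)\<close>; grouping the blocks by
  \<open>k = l - j\<close> yields the coefficients.\<close>

lemma sandwich_eq_pseudo_poly:
  assumes Y: "Y \<in> carrier_mat (n * (m + 1)) (n * (m + 1))"
  shows "sandwich n m Y = pseudo_poly n m (gram_coeff n m Y)"
proof
  fix \<theta>
  let ?p = "n * (m + 1)" and ?S = "shift_op n m \<theta>" and ?e = "\<lambda>j::nat. exp (\<i> * of_nat j * of_real \<theta>)"
  show "sandwich n m Y \<theta> = pseudo_poly n m (gram_coeff n m Y) \<theta>"
  proof (rule eq_matI)
    fix a b assume "a < dim_row (pseudo_poly n m (gram_coeff n m Y) \<theta>)" "b < dim_col (pseudo_poly n m (gram_coeff n m Y) \<theta>)"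
    then have ab: "a < n" "b < n" by (auto simp: pseudo_poly_def)
    \<comment> \<open>A row of the shift operator has exactly one nonzero entry in each
      block.\<close>
    have row: "(\<Sum>s<?p. ?S $$ (a, s) * g s) = (\<Sum>j\<le>m. ?e j * g (j * n + a))" if "a < n" for g a
    proof -
      have "(\<Sum>s<?p. ?S $$ (a, s) * g s) = (\<Sum>s<Suc m * n. ?S $$ (a, s) * g s)"
        by (simp add: mult.commute)
      also have "\<dots> = (\<Sum>j<Suc m. \<Sum>c<n. if c = a then ?e j * g (j * n + a) else 0)"
        unfolding sum_blocks
      proof (intro sum.cong refl)
        fix j c assume "j \<in> {..<Suc m}" "c \<in> {..<n}"
        then show "?S $$ (a, j * n + c) * g (j * n + c) = (if c = a then ?e j * g (j * n + a) else 0)"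
          using that block_index_less[of j m c n] by (auto simp: shift_op_def)
      qed
      also have "\<dots> = (\<Sum>j\<le>m. ?e j * g (j * n + a))"
        using that by (simp add: sum.delta lessThan_Suc_atMost)
      finally show ?thesis .
    qed
    have "sandwich n m Y \<theta> $$ (a, b)
        = (\<Sum>s<?p. ?S $$ (a, s) * cnj (\<Sum>t<?p. ?S $$ (b, t) * of_real (Y $$ (s, t))))"
      by (simp add: sandwich_index[OF Y ab] cnj_sum sum_distrib_left mult_ac)
    also have "\<dots> = (\<Sum>j\<le>m. ?e j * cnj (\<Sum>l\<le>m. ?e l * of_real (Y $$ (j * n + a, l * n + b))))"
      unfolding row[OF ab(1)] row[OF ab(2)] ..
    also have "\<dots> = (\<Sum>j\<le>m. \<Sum>l\<le>m. exp (- (\<i> * of_int (int l - int j) * of_real \<theta>)) * of_real (Y $$ (j * n + a, l * n + b)))"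
    proof -
      have "exp (- (\<i> * of_int (int l - int j) * of_real \<theta>)) = ?e j * cnj (?e l)" for j l
        by (simp add: exp_cnj algebra_simps flip: exp_add)
      then show ?thesis by (simp only: cnj_sum complex_cnj_mult complex_cnj_complex_of_real sum_distrib_left mult.assoc)
    qed
    \<comment> \<open>Inserts a sum over \<open>k\<close> with a single nonzero term, available
      since \<open>l - j\<close> lies in \<open>-m..m\<close>.\<close>
    also have "\<dots> = (\<Sum>j\<le>m. \<Sum>l\<le>m. \<Sum>k = - int m..int m. exp (- (\<i> * of_int k * of_real \<theta>)) *
         of_real (if int l - int j = k then Y $$ (j * n + a, l * n + b) else 0))"
    proof (intro sum.cong refl)
      fix j l assume "j \<in> {..m}" "l \<in> {..m}"
      then have "int l - int j \<in> {- int m..int m}" by auto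
      then have "exp (- (\<i> * of_int (int l - int j) * of_real \<theta>)) * of_real (Y $$ (j * n + a, l * n + b))
        = (\<Sum>k = - int m..int m. if k = int l - int j
            then exp (- (\<i> * of_int k * of_real \<theta>)) * complex_of_real (Y $$ (j * n + a, l * n + b)) else 0)"
        by (simp only: sum.delta finite_atLeastAtMost_int if_True)
      also have "\<dots> = (\<Sum>k = - int m..int m. exp (- (\<i> * of_int k * of_real \<theta>)) *
         of_real (if int l - int j = k then Y $$ (j * n + a, l * n + b) else 0))"
        by (intro sum.cong) auto
      finally show "exp (- (\<i> * of_int (int l - int j) * of_real \<theta>)) * complex_of_real (Y $$ (j * n + a, l * n + b)) = \<dots>" .
    qed
    also have "\<dots> = (\<Sum>k = - int m..int m. \<Sum>j\<le>m. \<Sum>l\<le>m. exp (- (\<i> * of_int k * of_real \<theta>)) *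
         of_real (if int l - int j = k then Y $$ (j * n + a, l * n + b) else 0))"
      by (rule trans[OF sum.cong[OF refl sum.swap] sum.swap])
    also have "\<dots> = pseudo_poly n m (gram_coeff n m Y) \<theta> $$ (a, b)"
      using ab by (simp add: pseudo_poly_def gram_coeff_def sum_distrib_left)
    finally show "sandwich n m Y \<theta> $$ (a, b) = pseudo_poly n m (gram_coeff n m Y) \<theta> $$ (a, b)" .
  qed (use sandwich_carrier[of n m Y \<theta>] in \<open>auto simp: pseudo_poly_def\<close>)
qed

lemma sum_swap_triple:
  "(\<Sum>a\<in>A. \<Sum>b\<in>B. \<Sum>s\<in>S. f a b s) = (\<Sum>s\<in>S. \<Sum>a\<in>A. \<Sum>b\<in>B. f a b s)"
  by (rule trans[OF sum.cong[OF refl sum.swap] sum.swap])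

lemma sum_swap_pairs:
  "(\<Sum>a\<in>A. \<Sum>b\<in>B. \<Sum>s\<in>S. \<Sum>t\<in>T. f a b s t) = (\<Sum>s\<in>S. \<Sum>t\<in>T. \<Sum>a\<in>A. \<Sum>b\<in>B. f a b s t)"
  by (rule trans[OF sum_swap_triple], rule sum.cong[OF refl], rule sum_swap_triple)

text \<open>The form at \<open>v\<close> is the form of \<open>Y\<close> at the complex vector
  \<open>\<Delta>^* v\<close>. For a real symmetric matrix this is the sum of the real forms at the
  real and imaginary parts.\<close>

lemma sandwich_psd:
  assumes Y: "Y \<in> sym_mats (n * (m + 1))" and psd: "psd Y"
  shows "circle_psd (sandwich n m Y)"
  unfolding circle_psd_def
proof
  fix \<theta>
  let ?p = "n * (m + 1)" and ?S = "shift_op n m \<theta>"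
  have Yc: "Y \<in> carrier_mat ?p ?p" using Y by (simp add: sym_mats_def)
  note Ys = sym_mats_index[OF Y]
  have real_psd: "0 \<le> quad_form ?p (\<lambda>i j. Y $$ (i, j)) v" for v
    using psd real_psd_iff[OF Y] by blast
  note ent = sandwich_index[OF Yc] and dims = sandwich_carrier[of n m Y \<theta>]
  show "psd (sandwich n m Y \<theta>)"
    unfolding psd_def
  proof (intro conjI ballI)
    show "square_mat (sandwich n m Y \<theta>)" using dims by auto
    show "mat_adjoint (sandwich n m Y \<theta>) = sandwich n m Y \<theta>"
    proof (rule eq_matI)
      fix a b assume "a < dim_row (sandwich n m Y \<theta>)" "b < dim_col (sandwich n m Y \<theta>)"
      then have ab: "a < n" "b < n" using dims by auto
      have "mat_adjoint (sandwich n m Y \<theta>) $$ (a, b)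
         = (\<Sum>s<?p. \<Sum>t<?p. ?S $$ (a, t) * of_real (Y $$ (s, t)) * cnj (?S $$ (b, s)))"
        using ab by (simp add: index_mat_adjoint[OF dims] ent cnj_sum mult_ac)
      also have "\<dots> = (\<Sum>t<?p. \<Sum>s<?p. ?S $$ (a, t) * of_real (Y $$ (s, t)) * cnj (?S $$ (b, s)))"
        by (rule sum.swap)
      also have "\<dots> = sandwich n m Y \<theta> $$ (a, b)"
        unfolding ent[OF ab] by (intro sum.cong refl) (simp add: Ys)
      finally show "mat_adjoint (sandwich n m Y \<theta>) $$ (a, b) = sandwich n m Y \<theta> $$ (a, b)" .
    qed (use dims mat_adjoint_carrier[OF dims] in auto)
    fix v :: "complex Matrix.vec" assume "v \<in> carrier_vec (dim_row (sandwich n m Y \<theta>))"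
    then have v: "v \<in> carrier_vec n" using dims by auto
    \<comment> \<open>The complex conjugate of entry \<open>s\<close> of
      \<open>\<Delta>^* v\<close>.\<close>
    define w where "w s = (\<Sum>a<n. ?S $$ (a, s) * cnj (vec_index v a))" for s
    have "(sandwich n m Y \<theta> *\<^sub>v v) \<bullet>c v
      = (\<Sum>a<n. \<Sum>b<n. \<Sum>s<?p. \<Sum>t<?p. ?S $$ (a, s) * of_real (Y $$ (s, t)) * cnj (?S $$ (b, t))
          * vec_index v b * cnj (vec_index v a))"
      by (simp add: cscalar_prod_mult_mat_vec[OF dims v] ent sum_distrib_right)
    also have "\<dots> = (\<Sum>s<?p. \<Sum>t<?p. \<Sum>a<n. \<Sum>b<n. ?S $$ (a, s) * of_real (Y $$ (s, t)) * cnj (?S $$ (b, t))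
          * vec_index v b * cnj (vec_index v a))"
      by (rule sum_swap_pairs)
    also have "\<dots> = (\<Sum>s<?p. \<Sum>t<?p. of_real (Y $$ (s, t)) * (w s * cnj (w t)))"
      by (simp add: w_def cnj_sum sum_product sum_distrib_left mult_ac)
    also have "\<dots> = of_real (quad_form ?p (\<lambda>i j. Y $$ (i, j)) (\<lambda>i. Re (w i))
         + quad_form ?p (\<lambda>i j. Y $$ (i, j)) (\<lambda>i. Im (w i)))"
    proof -
      \<comment> \<open>The imaginary part of the double sum is the sum of
        \<open>q s t - q t s\<close>, by symmetry of \<open>Y\<close>; exchanging the summation
        indices cancels it.\<close>
      define q where "q s t = Y $$ (s, t) * (Im (w s) * Re (w t))" for s t
      have "(\<Sum>s<?p. \<Sum>t<?p. of_real (Y $$ (s, t)) * (w s * cnj (w t)))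
         = of_real (quad_form ?p (\<lambda>i j. Y $$ (i, j)) (\<lambda>i. Re (w i))
         + quad_form ?p (\<lambda>i j. Y $$ (i, j)) (\<lambda>i. Im (w i)))
         + \<i> * of_real ((\<Sum>s<?p. \<Sum>t<?p. q s t) - (\<Sum>s<?p. \<Sum>t<?p. q t s))"
        unfolding quad_form_def of_real_add of_real_diff of_real_sum sum.distrib[symmetric]
          sum_subtractf[symmetric] sum_distrib_left
        by (intro sum.cong refl) (auto simp: q_def complex_eq_iff Ys algebra_simps)
      also have "(\<Sum>s<?p. \<Sum>t<?p. q t s) = (\<Sum>s<?p. \<Sum>t<?p. q s t)" by (rule sum.swap)
      finally show ?thesis by simp
    qed
    finally have "(sandwich n m Y \<theta> *\<^sub>v v) \<bullet>c v
       = of_real (quad_form ?p (\<lambda>i j. Y $$ (i, j)) (\<lambda>i. Re (w i))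
         + quad_form ?p (\<lambda>i j. Y $$ (i, j)) (\<lambda>i. Im (w i)))" .
    then show "0 \<le> (sandwich n m Y \<theta> *\<^sub>v v) \<bullet>c v"
      using real_psd by (simp add: less_eq_complex_def)
  qed
qed

section \<open>Recovering coefficients from values on the circle\<close>

lemma pseudo_poly_index:
  assumes "a < n" "b < n"
  shows "pseudo_poly n m Q \<theta> $$ (a, b)
    = (\<Sum>k = - int m..int m. exp (- (\<i> * of_int k * of_real \<theta>)) * of_real (Q k $$ (a, b)))"
  using assms by (simp add: pseudo_poly_def)

lemma pseudo_poly_cong:
  assumes "\<And>k. k \<in> {- int m..int m} \<Longrightarrow> Q k = Q' k"
  shows "pseudo_poly n m Q = pseudo_poly n m Q'"
  unfolding pseudo_poly_def using assms by (intro ext cong_mat) (auto intro!: sum.cong)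

lemma pseudo_poly_add:
  assumes "\<And>k. k \<in> {- int m..int m} \<Longrightarrow> Q k \<in> carrier_mat n n"
    and "\<And>k. k \<in> {- int m..int m} \<Longrightarrow> Q' k \<in> carrier_mat n n"
  shows "pseudo_poly n m (\<lambda>k. Q k + Q' k) \<theta> = pseudo_poly n m Q \<theta> + pseudo_poly n m Q' \<theta>"
proof (rule eq_matI)
  fix a b assume "a < dim_row (pseudo_poly n m Q \<theta> + pseudo_poly n m Q' \<theta>)"
    "b < dim_col (pseudo_poly n m Q \<theta> + pseudo_poly n m Q' \<theta>)"
  then have ab: "a < n" "b < n" by (auto simp: pseudo_poly_def)
  have "(Q k + Q' k) $$ (a, b) = Q k $$ (a, b) + Q' k $$ (a, b)" if "k \<in> {- int m..int m}" for k
    using assms(2)[OF that] ab by simp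
  then have "pseudo_poly n m (\<lambda>k. Q k + Q' k) \<theta> $$ (a, b)
     = pseudo_poly n m Q \<theta> $$ (a, b) + pseudo_poly n m Q' \<theta> $$ (a, b)"
    by (simp add: pseudo_poly_index[OF ab] distrib_left sum.distrib del: index_add_mat)
  then show "pseudo_poly n m (\<lambda>k. Q k + Q' k) \<theta> $$ (a, b)
     = (pseudo_poly n m Q \<theta> + pseudo_poly n m Q' \<theta>) $$ (a, b)"
    using ab by (simp add: pseudo_poly_def)
qed (auto simp: pseudo_poly_def)

lemma pseudo_poly_fourier_coeff:
  assumes ab: "a < n" "b < n" and l: "l \<in> {- int m..int m}"
  shows "((\<lambda>\<theta>. exp (\<i> * of_int l * of_real \<theta>) * pseudo_poly n m Q \<theta> $$ (a, b))
    has_integral of_real (2 * pi * Q l $$ (a, b))) {-pi..pi}"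
proof -
  have "exp (\<i> * of_int l * of_real \<theta>) * pseudo_poly n m Q \<theta> $$ (a, b)
    = (\<Sum>k = - int m..int m. exp (\<i> * of_int (l - k) * of_real \<theta>) * of_real (Q k $$ (a, b)))" for \<theta>
  proof -
    have "\<i> * of_int (l - k) * of_real \<theta> = \<i> * of_int l * of_real \<theta> + - (\<i> * of_int k * of_real \<theta>)" for k
      by (simp add: algebra_simps)
    then show ?thesis
      by (simp only: pseudo_poly_index[OF ab] sum_distrib_left exp_add mult.assoc)
  qed
  then have eq: "(\<lambda>\<theta>. exp (\<i> * of_int l * of_real \<theta>) * pseudo_poly n m Q \<theta> $$ (a, b))
    = (\<lambda>\<theta>. \<Sum>k = - int m..int m. exp (\<i> * of_int (l - k) * of_real \<theta>) * of_real (Q k $$ (a, b)))"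
    by (rule ext)
  have "(\<Sum>k = - int m..int m. (if l - k = 0 then of_real (2 * pi) else 0) * complex_of_real (Q k $$ (a, b)))
    = (\<Sum>k = - int m..int m. if k = l then of_real (2 * pi * Q k $$ (a, b)) else 0)"
    by (intro sum.cong) auto
  also have "\<dots> = of_real (2 * pi * Q l $$ (a, b))" using l by (simp add: sum.delta)
  finally have val: "of_real (2 * pi * Q l $$ (a, b))
    = (\<Sum>k = - int m..int m. (if l - k = 0 then of_real (2 * pi) else 0) * complex_of_real (Q k $$ (a, b)))" ..
  show ?thesis
    unfolding eq val
    by (intro has_integral_sum has_integral_mult_left exp_int_has_integral finite_atLeastAtMost_int)
qed

text \<open>Equal functions have equal Fourier integrals. The entrywise form serves both the
  vanishing of off-diagonal entries and the splitting of \<open>\<Psi>x\<close>.\<close>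

lemma pseudo_poly_coeff_unique:
  assumes ab: "a < n" "b < n" and l: "l \<in> {- int m..int m}"
    and eq: "\<And>\<theta>. \<theta> \<in> {-pi..pi} \<Longrightarrow> pseudo_poly n m Q \<theta> $$ (a, b) = pseudo_poly n m Q' \<theta> $$ (a, b)"
  shows "Q l $$ (a, b) = Q' l $$ (a, b)"
proof -
  have "((\<lambda>\<theta>. exp (\<i> * of_int l * of_real \<theta>) * pseudo_poly n m Q \<theta> $$ (a, b))
    has_integral of_real (2 * pi * Q' l $$ (a, b))) {-pi..pi}"
    using pseudo_poly_fourier_coeff[OF ab l, of Q'] by (rule has_integral_eq[rotated]) (simp add: eq)
  from has_integral_unique[OF this pseudo_poly_fourier_coeff[OF ab l]]
  show ?thesis using pi_gt_zero by (simp flip: of_real_mult)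
qed

text \<open>The factor \<open>2 * pi\<close> of the zeroth Fourier integral cancels the
  normalisation in \<open>circle_integral\<close>. With \<open>trace_eq_trace_D_map\<close>, both
  objectives become the trace of a zeroth coefficient.\<close>

lemma P_objective_pseudo_poly:
  "P_objective n (pseudo_poly n m Q, \<Psi>) = (\<Sum>a<n. Q 0 $$ (a, a))"
proof -
  have "integral {-pi..pi} (\<lambda>\<theta>. pseudo_poly n m Q \<theta> $$ (a, a)) = of_real (2 * pi * Q 0 $$ (a, a))"
    if "a < n" for a
    using pseudo_poly_fourier_coeff[OF that that, of 0 m Q] by (simp add: integral_unique)
  then show ?thesis by (simp add: P_objective_def trace_mat_def circle_integral_def)
qed

lemma trace_eq_trace_D_map:
  assumes "Y \<in> carrier_mat (n * (m + 1)) (n * (m + 1))"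
  shows "trace_mat Y = (\<Sum>a<n. D_map n m 0 Y $$ (a, a))"
proof -
  have "trace_mat Y = (\<Sum>i<Suc m * n. Y $$ (i, i))"
    using assms by (simp add: trace_mat_def mult.commute)
  also have "\<dots> = (\<Sum>a<n. \<Sum>j<Suc m. Y $$ (j * n + a, j * n + a))"
    unfolding sum_blocks by (rule sum.swap)
  also have "\<dots> = (\<Sum>a<n. D_map n m 0 Y $$ (a, a))"
    by (intro sum.cong refl) (simp add: D_map_index lessThan_Suc_atMost atMost_atLeast0)
  finally show ?thesis .
qed

text \<open>(S) constrains only \<open>k \<ge> 0\<close>; the rule
  \<open>Q k = transpose_mat (Q (- k))\<close> determines the rest.\<close>

lemma coeff_family_eqI:
  assumes "coeff_family n m Q" "coeff_family n m Q'"
    and eq: "\<And>k. k \<le> m \<Longrightarrow> Q (int k) = Q' (int k)" and k: "k \<in> {- int m..int m}"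
  shows "Q k = Q' k"
proof (cases "0 \<le> k")
  case True
  then show ?thesis using eq[of "nat k"] k by simp
next
  case False
  then have "Q (- k) = Q' (- k)" using eq[of "nat (- k)"] k by simp
  moreover have "Q k = transpose_mat (Q (- k))" "Q' k = transpose_mat (Q' (- k))"
    using assms(1,2) k unfolding coeff_family_def by blast+
  ultimately show ?thesis by simp
qed

lemma D_map_add:
  assumes "Y \<in> carrier_mat (n * (m + 1)) (n * (m + 1))" "Z \<in> carrier_mat (n * (m + 1)) (n * (m + 1))"
    and "k \<le> m"
  shows "D_map n m k (Y + Z) = D_map n m k Y + D_map n m k Z"
proof (rule eq_matI)
  fix a b assume "a < dim_row (D_map n m k Y + D_map n m k Z)" "b < dim_col (D_map n m k Y + D_map n m k Z)"
  then have ab: "a < n" "b < n" by (auto simp: D_map_def)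
  have "(Y + Z) $$ (j * n + a, (j + k) * n + b) = Y $$ (j * n + a, (j + k) * n + b) + Z $$ (j * n + a, (j + k) * n + b)"
    if "j \<in> {0..m - k}" for j
  proof -
    have "j * n + a < n * (m + 1)" "(j + k) * n + b < n * (m + 1)"
      using that ab \<open>k \<le> m\<close> by (intro block_index_less; simp)+
    then show ?thesis using assms by (subst index_add_mat) auto
  qed
  then have "D_map n m k (Y + Z) $$ (a, b) = D_map n m k Y $$ (a, b) + D_map n m k Z $$ (a, b)"
    by (simp add: D_map_index[OF ab] sum.distrib del: index_add_mat)
  then show "D_map n m k (Y + Z) $$ (a, b) = (D_map n m k Y + D_map n m k Z) $$ (a, b)"
    using ab by (simp add: D_map_def)
qed (auto simp: D_map_def)

section \<open>Equivalence of the two problems\<close>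

text \<open>From (S) to (P): the coefficients of the sandwiches are the \<open>D_map\<close> values,
  so the linear constraints carry over once they are extended to negative indices by
  transposition.\<close>

lemma sandwich_P_feasible:
  assumes R: "coeff_family n m R" and S: "S_feasible n m R (Y, Z)"
  shows "P_feasible n m (pseudo_poly n m R) (sandwich n m Y, sandwich n m Z)"
    and "P_objective n (sandwich n m Y, \<Psi>) = S_objective (Y, Z)"
proof -
  let ?p = "n * (m + 1)"
  have sym: "Y \<in> sym_mats ?p" "Z \<in> sym_mats ?p" and psd: "psd Y" "psd Z"
    and diag: "\<And>k. k \<le> m \<Longrightarrow> diagonal_mat (D_map n m k Z)"
    and sum: "\<And>k. k \<le> m \<Longrightarrow> D_map n m k (Y + Z) = R (int k)"
    using S by (auto simp: S_feasible_def)
  have Y: "Y \<in> carrier_mat ?p ?p" and Z: "Z \<in> carrier_mat ?p ?p"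
    using sym by (auto simp: sym_mats_def)
  let ?QY = "gram_coeff n m Y" and ?QZ = "gram_coeff n m Z"
  have fam: "coeff_family n m ?QY" "coeff_family n m ?QZ"
    using gram_coeff_family sym by blast+
  have car: "gram_coeff n m X k \<in> carrier_mat n n" for X k by (simp add: gram_coeff_def)
  have "R k = ?QY k + ?QZ k" if "k \<in> {- int m..int m}" for k
  proof (rule coeff_family_eqI[OF R _ _ that])
    show "coeff_family n m (\<lambda>k. ?QY k + ?QZ k)"
      unfolding coeff_family_def
    proof (intro ballI conjI)
      fix k assume k: "k \<in> {- int m..int m}"
      show "?QY k + ?QZ k \<in> carrier_mat n n" using car by simp
      have "?QY k = transpose_mat (?QY (- k))" "?QZ k = transpose_mat (?QZ (- k))"
        using fam k unfolding coeff_family_def by blast+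
      then show "?QY k + ?QZ k = transpose_mat (?QY (- k) + ?QZ (- k))"
        using transpose_add[OF car car] by metis
    qed
    show "R (int k) = ?QY (int k) + ?QZ (int k)" if "k \<le> m" for k
      using sum[OF that] D_map_add[OF Y Z that] D_map_eq_gram_coeff[OF that] by metis
  qed
  then have "pseudo_poly n m R = pseudo_poly n m (\<lambda>k. ?QY k + ?QZ k)"
    by (rule pseudo_poly_cong)
  then have split: "pseudo_poly n m R \<theta> = sandwich n m Y \<theta> + sandwich n m Z \<theta>" for \<theta>
    using pseudo_poly_add[OF car car] by (simp add: sandwich_eq_pseudo_poly[OF Y] sandwich_eq_pseudo_poly[OF Z])
  \<comment> \<open>For negative \<open>k\<close> the entry is the \<open>(b, a)\<close> entry of
    the coefficient at \<open>- k\<close>, again off the diagonal.\<close>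
  have zero: "?QZ k $$ (a, b) = 0" if "k \<in> {- int m..int m}" "a < n" "b < n" "a \<noteq> b" for k a b
  proof -
    have pos: "?QZ (int k) $$ (a, b) = 0" if "k \<le> m" "a < n" "b < n" "a \<noteq> b" for k a b
      using diag[OF that(1)] that D_map_carrier[of n m k Z]
      by (auto simp: diagonal_mat_def D_map_eq_gram_coeff[OF that(1), symmetric])
    show ?thesis
    proof (cases "0 \<le> k")
      case True
      then show ?thesis using pos[of "nat k" a b] that by simp
    next
      case False
      have "?QZ k = transpose_mat (?QZ (- k))"
        using fam(2) that(1) unfolding coeff_family_def by blast
      then have "?QZ k $$ (a, b) = ?QZ (- k) $$ (b, a)"
        using car[of Z "- k"] that by (metis carrier_matD index_transpose_mat(1))
      then show ?thesis using pos[of "nat (- k)" b a] that False by simp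
    qed
  qed
  have "circle_diagonal (sandwich n m Z)"
    unfolding circle_diagonal_def diagonal_mat_def sandwich_eq_pseudo_poly[OF Z]
    by (auto simp: carrier_matD[OF pseudo_poly_carrier] pseudo_poly_index zero)
  then show "P_feasible n m (pseudo_poly n m R) (sandwich n m Y, sandwich n m Z)"
    unfolding P_feasible_def pseudo_polys_def prod.case
    using sandwich_psd[OF sym(1) psd(1)] sandwich_psd[OF sym(2) psd(2)] split fam
      sandwich_eq_pseudo_poly[OF Y] sandwich_eq_pseudo_poly[OF Z] by blast
  have "P_objective n (sandwich n m Y, \<Psi>) = (\<Sum>a<n. D_map n m 0 Y $$ (a, a))"
    using D_map_eq_gram_coeff[of 0 m n Y]
    by (simp add: sandwich_eq_pseudo_poly[OF Y] P_objective_pseudo_poly)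
  then show "P_objective n (sandwich n m Y, \<Psi>) = S_objective (Y, Z)"
    by (simp add: S_objective_def trace_eq_trace_D_map[OF Y])
qed

text \<open>From (P) to (S): the two summands get Gram matrices independently. The constraints of
  (S) see these only through \<open>D_map\<close>, that is, through Fourier coefficients, which the
  functions determine.\<close>

lemma P_feasible_imp_S_feasible:
  assumes n: "n \<ge> 1" and R: "coeff_family n m R"
    and P: "P_feasible n m (pseudo_poly n m R) (\<Psi>y, \<Psi>z)"
  shows "\<exists>Y Z. S_feasible n m R (Y, Z) \<and> S_objective (Y, Z) = P_objective n (\<Psi>y, \<Psi>z)"
proof -
  let ?p = "n * (m + 1)"
  obtain Qy Qz where y: "\<Psi>y = pseudo_poly n m Qy" "coeff_family n m Qy"
    and z: "\<Psi>z = pseudo_poly n m Qz" "coeff_family n m Qz"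
    and psd: "circle_psd \<Psi>y" "circle_psd \<Psi>z" and diag: "circle_diagonal \<Psi>z"
    and sum: "\<And>\<theta>. \<theta> \<in> {-pi..pi} \<Longrightarrow> pseudo_poly n m R \<theta> = \<Psi>y \<theta> + \<Psi>z \<theta>"
    using P unfolding P_feasible_def pseudo_polys_def prod.case by blast
  obtain Y where Y: "Y \<in> sym_mats ?p" "psd Y" "\<And>k. k \<le> m \<Longrightarrow> D_map n m k Y = Qy (int k)"
    using psd_gram_matrix_exists[OF y(2) _ n] psd(1) y(1) by auto
  obtain Z where Z: "Z \<in> sym_mats ?p" "psd Z" "\<And>k. k \<le> m \<Longrightarrow> D_map n m k Z = Qz (int k)"
    using psd_gram_matrix_exists[OF z(2) _ n] psd(2) z(1) by auto
  have Yc: "Y \<in> carrier_mat ?p ?p" and Zc: "Z \<in> carrier_mat ?p ?p"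
    using Y Z by (auto simp: sym_mats_def)
  have car: "Q k \<in> carrier_mat n n" if "coeff_family n m Q" "k \<in> {- int m..int m}" for Q k
    using that unfolding coeff_family_def by blast
  have "diagonal_mat (D_map n m k Z)" if "k \<le> m" for k
    unfolding diagonal_mat_def
  proof (intro allI impI)
    fix a b assume "a < dim_row (D_map n m k Z)" "b < dim_col (D_map n m k Z)" and ne: "a \<noteq> b"
    then have ab: "a < n" "b < n" using D_map_carrier[of n m k Z] by auto
    have k: "int k \<in> {- int m..int m}" using that by auto
    have "Qz (int k) $$ (a, b) = 0\<^sub>m n n $$ (a, b)"
    \<comment> \<open>Comparison with the zero family: an off-diagonal entry that vanishes on the
      circle has vanishing coefficients.\<close>
    proof (rule pseudo_poly_coeff_unique[OF ab k, where Q' = "\<lambda>_. 0\<^sub>m n n"])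
      fix \<theta> :: real assume "\<theta> \<in> {-pi..pi}"
      then have "diagonal_mat (\<Psi>z \<theta>)" using diag by (simp add: circle_diagonal_def)
      then show "pseudo_poly n m Qz \<theta> $$ (a, b) = pseudo_poly n m (\<lambda>_. 0\<^sub>m n n) \<theta> $$ (a, b)"
        using ab ne pseudo_poly_carrier[of n m Qz \<theta>]
        by (simp add: diagonal_mat_def z(1) pseudo_poly_index[OF ab, of m "\<lambda>_. 0\<^sub>m n n"])
    qed
    then show "D_map n m k Z $$ (a, b) = 0" using Z(3)[OF that] ab by simp
  qed
  moreover have "D_map n m k (Y + Z) = R (int k)" if "k \<le> m" for k
  proof -
    have k: "int k \<in> {- int m..int m}" using that by auto
    have "R (int k) = Qy (int k) + Qz (int k)"
    proof (rule eq_matI)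
      fix a b assume "a < dim_row (Qy (int k) + Qz (int k))" "b < dim_col (Qy (int k) + Qz (int k))"
      then have ab: "a < n" "b < n" using car[OF z(2) k] by auto
      show "R (int k) $$ (a, b) = (Qy (int k) + Qz (int k)) $$ (a, b)"
      proof (rule pseudo_poly_coeff_unique[OF ab k, where Q' = "\<lambda>k. Qy k + Qz k"])
        fix \<theta> :: real assume "\<theta> \<in> {-pi..pi}"
        then show "pseudo_poly n m R \<theta> $$ (a, b) = pseudo_poly n m (\<lambda>k. Qy k + Qz k) \<theta> $$ (a, b)"
          using sum pseudo_poly_add[OF car[OF y(2)] car[OF z(2)]] by (simp add: y(1) z(1))
      qed
    qed (use car[OF R k] car[OF z(2) k] in auto)
    then show ?thesis using D_map_add[OF Yc Zc that] Y(3) Z(3) that by simp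
  qed
  ultimately have "S_feasible n m R (Y, Z)"
    using Y Z by (simp add: S_feasible_def)
  moreover have "S_objective (Y, Z) = P_objective n (\<Psi>y, \<Psi>z)"
    using Y(3)[of 0] by (simp add: S_objective_def trace_eq_trace_D_map[OF Yc] y(1) P_objective_pseudo_poly)
  ultimately show ?thesis by blast
qed

theorem mainTheorem2:
  fixes n m :: nat
    and R :: "int \<Rightarrow> real mat"
    and \<Psi>x :: circle_fun
  assumes "n \<ge> 1"
    and "coeff_family n m R"
    and "\<Psi>x = pseudo_poly n m R"
    and "circle_psd \<Psi>x"
  shows "optimal_value (P_objective n) (P_feasible n m \<Psi>x)
           = optimal_value S_objective (S_feasible n m R)
       \<and> (\<forall>Y Z. is_arg_min S_objective (S_feasible n m R) (Y, Z) \<longrightarrow>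
            is_arg_min (P_objective n) (P_feasible n m \<Psi>x) (sandwich n m Y, sandwich n m Z))"
proof -
  note to_P = sandwich_P_feasible[OF assms(2), folded assms(3)]
    and to_S = P_feasible_imp_S_feasible[OF assms(1,2), folded assms(3)]
  \<comment> \<open>The two problems attain the same set of values, which gives equal infima whether
    or not minimizers exist.\<close>
  have "P_objective n ` Collect (P_feasible n m \<Psi>x) = S_objective ` Collect (S_feasible n m R)"
  proof (intro equalityI subsetI)
    fix x assume "x \<in> P_objective n ` Collect (P_feasible n m \<Psi>x)"
    then obtain \<Psi>y \<Psi>z where "P_feasible n m \<Psi>x (\<Psi>y, \<Psi>z)" "x = P_objective n (\<Psi>y, \<Psi>z)"
      by (metis imageE mem_Collect_eq surj_pair)
    then show "x \<in> S_objective ` Collect (S_feasible n m R)"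
      using to_S by (metis imageI mem_Collect_eq)
  next
    fix x assume "x \<in> S_objective ` Collect (S_feasible n m R)"
    then obtain Y Z where "S_feasible n m R (Y, Z)" "x = S_objective (Y, Z)"
      by (metis imageE mem_Collect_eq surj_pair)
    then show "x \<in> P_objective n ` Collect (P_feasible n m \<Psi>x)"
      using to_P by (metis imageI mem_Collect_eq)
  qed
  then have "optimal_value (P_objective n) (P_feasible n m \<Psi>x) = optimal_value S_objective (S_feasible n m R)"
    unfolding optimal_value_def by (metis image_image)
  moreover have "is_arg_min (P_objective n) (P_feasible n m \<Psi>x) (sandwich n m Y, sandwich n m Z)"
    if "is_arg_min S_objective (S_feasible n m R) (Y, Z)" for Y Z
  proof -
    have S: "S_feasible n m R (Y, Z)" and
      min: "\<And>W. S_feasible n m R W \<Longrightarrow> S_objective (Y, Z) \<le> S_objective W"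
      using that by (auto simp: is_arg_min_linorder)
    have "P_objective n (sandwich n m Y, sandwich n m Z) \<le> P_objective n \<Psi>"
      if P: "P_feasible n m \<Psi>x \<Psi>" for \<Psi>
    proof -
      \<comment> \<open>A competitor in (P) is lifted to a feasible pair of (S) with the same value,
        where minimality of \<open>(Y, Z)\<close> applies.\<close>
      obtain Y' Z' where "S_feasible n m R (Y', Z')" "S_objective (Y', Z') = P_objective n \<Psi>"
        using to_S P by (cases \<Psi>) blast
      then show ?thesis using min to_P(2)[OF S] by metis
    qed
    then show ?thesis using to_P(1)[OF S] by (simp add: is_arg_min_linorder)
  qed
  ultimately show ?thesis by blast
qed

end
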